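(* Let $C=e_1C_1\oplus e_2C_2\oplus e_3C_3$ be a cyclic code of length $n$ over $R$, and let $g_1(x),g_2(x),g_3(x)$ be the generator polynomials of $C_1,C_2,C_3$ respectively. Then $C=\langle e_1g_1(x),e_2g_2(x),e_3g_3(x)\rangle$ and $$|C|=p^{3n-\deg(g_1)-\deg(g_2)-\deg(g_3)}.$$
   Context: Let $p$ be a prime, $k\ge1$ and $r>1$ integers with $\gcd(r,p)=1$, and $R_r=\mathbb{F}_{p^k}[v]/\langle v^{r+1}-v\rangle$. In $R_r$ put $e_1=\frac1r(v+v^2+\dots+v^r)$, $e_2=-\frac1r(v+\dots+v^{r-1})+\frac{r-1}{r}v^r$, $e_3=1-v^r$; these are nonzero orthogonal idempotents with sum $1$. $R$ denotes the subring $R=e_1\mathbb{F}_{p^k}\oplus e_2\mathbb{F}_{p^k}\oplus e_3\mathbb{F}_{p^k}$ of $R_r$. A cyclic code of length $n$ over a commutative ring $A$ is an $A$-submodule of $A^n$ stable under $(c_0,\dots,c_{n-1})\mapsto(c_{n-1},c_0,\dots,c_{n-2})$; identifying $(c_0,\dots,c_{n-1})$ with $\sum c_ix^i$, cyclic codes are the ideals of $A[x]/(x^n-1)$, and $\langle\cdots\rangle$ denotes the ideal generated in $R[x]/(x^n-1)$. For a linear code $C$ over $R$, the associated codes are $C_1=\{s\in\mathbb{F}_{p^k}^n : \exists\, t,u\in\mathbb{F}_{p^k}^n,\ e_1s+e_2t+e_3u\in C\}$, $C_2=\{t\in\mathbb{F}_{p^k}^n : \exists\, s,u\in\mathbb{F}_{p^k}^n,\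 e_1s+e_2t+e_3u\in C\}$, $C_3=\{u\in\mathbb{F}_{p^k}^n : \exists\, s,t\in\mathbb{F}_{p^k}^n,\ e_1s+e_2t+e_3u\in C\}$, and $C=e_1C_1\oplus e_2C_2\oplus e_3C_3$; if $C$ is cyclic, so are the $C_i$. The generator polynomial of a cyclic code over $\mathbb{F}_{p^k}$ is, as usual, the monic divisor of $x^n-1$ in $\mathbb{F}_{p^k}[x]$ generating it.
   Formalization: The size formula is corrected to |C| = p^{k(3n − deg g1 − deg g2 − deg g3)}; the printed one, lacking the factor k, fails for k > 1 (e.g. k = 2, C = R^n, all g_i = 1 gives p^{6n}, not p^{3n}) and agrees for k = 1. *)

theory Defs
  imports
    "HOL-Computational_Algebra.Primes"
    "HOL-Algebra.UnivPoly"
    "HOL-Algebra.QuotRing"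
    "HOL-Algebra.Divisibility"
begin

text \<open>
  Words of length \<open>n\<close> over \<open>A\<close> are extensional functions on \<open>{..<n}\<close>; the ring
  operations of the module record \<open>A\<^sup>n\<close> are componentwise.
\<close>

definition word_module :: "('a, 'm) ring_scheme \<Rightarrow> nat \<Rightarrow> ('a, nat \<Rightarrow> 'a) module" where
  "word_module A n = \<lparr>
     carrier = {..<n} \<rightarrow>\<^sub>E carrier A,
     mult = (\<lambda>c d. \<lambda>i\<in>{..<n}. c i \<otimes>\<^bsub>A\<^esub> d i),
     one = (\<lambda>i\<in>{..<n}. \<one>\<^bsub>A\<^esub>),
     zero = (\<lambda>i\<in>{..<n}. \<zero>\<^bsub>A\<^esub>),
     add = (\<lambda>c d. \<lambda>i\<in>{..<n}. c i \<oplus>\<^bsub>A\<^esub> d i),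
     smult = (\<lambda>a c. \<lambda>i\<in>{..<n}. a \<otimes>\<^bsub>A\<^esub> c i)\<rparr>"

definition cyclic_shift :: "nat \<Rightarrow> (nat \<Rightarrow> 'a) \<Rightarrow> (nat \<Rightarrow> 'a)" where
  "cyclic_shift n c = (\<lambda>i\<in>{..<n}. if i = 0 then c (n - 1) else c (i - 1))"

definition cyclic_code :: "('a, 'm) ring_scheme \<Rightarrow> nat \<Rightarrow> (nat \<Rightarrow> 'a) set \<Rightarrow> bool" where
  "cyclic_code A n C \<longleftrightarrow> submodule C A (word_module A n) \<and> (\<forall>c\<in>C. cyclic_shift n c \<in> C)"

definition xn_minus_1 :: "('a, 'm) ring_scheme \<Rightarrow> nat \<Rightarrow> (nat \<Rightarrow> 'a)" where
  "xn_minus_1 A n = monom (UP A) \<one>\<^bsub>A\<^esub> n \<ominus>\<^bsub>UP A\<^esub> \<one>\<^bsub>UP A\<^esub>"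

text \<open>The ring \<open>A[x]/(x\<^sup>n - 1)\<close> and the residue class of a polynomial in it.\<close>

definition cyclic_ring :: "('a, 'm) ring_scheme \<Rightarrow> nat \<Rightarrow> (nat \<Rightarrow> 'a) set ring" where
  "cyclic_ring A n = UP A Quot (PIdl\<^bsub>UP A\<^esub> (xn_minus_1 A n))"

definition cyclic_class :: "('a, 'm) ring_scheme \<Rightarrow> nat \<Rightarrow> (nat \<Rightarrow> 'a) \<Rightarrow> (nat \<Rightarrow> 'a) set" where
  "cyclic_class A n f = (PIdl\<^bsub>UP A\<^esub> (xn_minus_1 A n)) +>\<^bsub>UP A\<^esub> f"

definition word_poly :: "('a, 'm) ring_scheme \<Rightarrow> nat \<Rightarrow> (nat \<Rightarrow> 'a) \<Rightarrow> (nat \<Rightarrow> 'a)" where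
  "word_poly A n c = (\<Oplus>\<^bsub>UP A\<^esub>i\<in>{..<n}. monom (UP A) (c i) i)"

text \<open>The image of a code under the identification of \<open>A\<^sup>n\<close> with \<open>A[x]/(x\<^sup>n - 1)\<close>.\<close>

definition code_classes :: "('a, 'm) ring_scheme \<Rightarrow> nat \<Rightarrow> (nat \<Rightarrow> 'a) set \<Rightarrow> (nat \<Rightarrow> 'a) set set" where
  "code_classes A n C = (\<lambda>c. cyclic_class A n (word_poly A n c)) ` C"

text \<open>For the zero code the generator polynomial is \<open>x\<^sup>n - 1\<close> itself.\<close>

definition generator_poly ::
    "('a, 'm) ring_scheme \<Rightarrow> nat \<Rightarrow> (nat \<Rightarrow> 'a) set \<Rightarrow> (nat \<Rightarrow> 'a) \<Rightarrow> bool" where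
  "generator_poly F n C g \<longleftrightarrow>
     g \<in> carrier (UP F) \<and>
     coeff (UP F) g (deg F g) = \<one>\<^bsub>F\<^esub> \<and>
     g divides\<^bsub>UP F\<^esub> xn_minus_1 F n \<and>
     code_classes F n C = PIdl\<^bsub>cyclic_ring F n\<^esub> (cyclic_class F n g)"

text \<open>\<open>F[v]/(v\<^sup>r\<^sup>+\<^sup>1 - v)\<close>, with \<open>v_elem\<close> and \<open>v_const\<close> the classes of \<open>v\<close> and of constants.\<close>

definition v_ideal :: "('a, 'm) ring_scheme \<Rightarrow> nat \<Rightarrow> (nat \<Rightarrow> 'a) set" where
  "v_ideal F r =
     PIdl\<^bsub>UP F\<^esub> (monom (UP F) \<one>\<^bsub>F\<^esub> (r + 1) \<ominus>\<^bsub>UP F\<^esub> monom (UP F) \<one>\<^bsub>F\<^esub> 1)"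

definition v_ring :: "('a, 'm) ring_scheme \<Rightarrow> nat \<Rightarrow> (nat \<Rightarrow> 'a) set ring" where
  "v_ring F r = UP F Quot v_ideal F r"

definition v_elem :: "('a, 'm) ring_scheme \<Rightarrow> nat \<Rightarrow> (nat \<Rightarrow> 'a) set" where
  "v_elem F r = v_ideal F r +>\<^bsub>UP F\<^esub> monom (UP F) \<one>\<^bsub>F\<^esub> 1"

definition v_const :: "('a, 'm) ring_scheme \<Rightarrow> nat \<Rightarrow> 'a \<Rightarrow> (nat \<Rightarrow> 'a) set" where
  "v_const F r a = v_ideal F r +>\<^bsub>UP F\<^esub> monom (UP F) a 0"

definition frac_r :: "('a, 'm) ring_scheme \<Rightarrow> nat \<Rightarrow> nat \<Rightarrow> 'a" where
  "frac_r F r m = ([m] \<cdot>\<^bsub>F\<^esub> \<one>\<^bsub>F\<^esub>) \<otimes>\<^bsub>F\<^esub> inv\<^bsub>F\<^esub> ([r] \<cdot>\<^bsub>F\<^esub> \<one>\<^bsub>F\<^esub>)"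

definition e1 :: "('a, 'm) ring_scheme \<Rightarrow> nat \<Rightarrow> (nat \<Rightarrow> 'a) set" where
  "e1 F r = v_const F r (frac_r F r 1) \<otimes>\<^bsub>v_ring F r\<^esub>
     (\<Oplus>\<^bsub>v_ring F r\<^esub>i\<in>{1..r}. v_elem F r [^]\<^bsub>v_ring F r\<^esub> i)"

definition e2 :: "('a, 'm) ring_scheme \<Rightarrow> nat \<Rightarrow> (nat \<Rightarrow> 'a) set" where
  "e2 F r =
     (\<ominus>\<^bsub>v_ring F r\<^esub> (v_const F r (frac_r F r 1) \<otimes>\<^bsub>v_ring F r\<^esub>
        (\<Oplus>\<^bsub>v_ring F r\<^esub>i\<in>{1..r - 1}. v_elem F r [^]\<^bsub>v_ring F r\<^esub> i)))
     \<oplus>\<^bsub>v_ring F r\<^esub>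
     (v_const F r (frac_r F r (r - 1)) \<otimes>\<^bsub>v_ring F r\<^esub> v_elem F r [^]\<^bsub>v_ring F r\<^esub> r)"

definition e3 :: "('a, 'm) ring_scheme \<Rightarrow> nat \<Rightarrow> (nat \<Rightarrow> 'a) set" where
  "e3 F r = \<one>\<^bsub>v_ring F r\<^esub> \<ominus>\<^bsub>v_ring F r\<^esub> v_elem F r [^]\<^bsub>v_ring F r\<^esub> r"

definition e_comb :: "('a, 'm) ring_scheme \<Rightarrow> nat \<Rightarrow> 'a \<Rightarrow> 'a \<Rightarrow> 'a \<Rightarrow> (nat \<Rightarrow> 'a) set" where
  "e_comb F r a b c =
     (e1 F r \<otimes>\<^bsub>v_ring F r\<^esub> v_const F r a) \<oplus>\<^bsub>v_ring F r\<^esub>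
     (e2 F r \<otimes>\<^bsub>v_ring F r\<^esub> v_const F r b) \<oplus>\<^bsub>v_ring F r\<^esub>
     (e3 F r \<otimes>\<^bsub>v_ring F r\<^esub> v_const F r c)"

definition R_ring :: "('a, 'm) ring_scheme \<Rightarrow> nat \<Rightarrow> (nat \<Rightarrow> 'a) set ring" where
  "R_ring F r = (v_ring F r)\<lparr>carrier :=
     {e_comb F r a b c | a b c. a \<in> carrier F \<and> b \<in> carrier F \<and> c \<in> carrier F}\<rparr>"

definition word_comb :: "('a, 'm) ring_scheme \<Rightarrow> nat \<Rightarrow> nat \<Rightarrow>
    (nat \<Rightarrow> 'a) \<Rightarrow> (nat \<Rightarrow> 'a) \<Rightarrow> (nat \<Rightarrow> 'a) \<Rightarrow> (nat \<Rightarrow> (nat \<Rightarrow> 'a) set)" where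
  "word_comb F r n s t u = (\<lambda>i\<in>{..<n}. e_comb F r (s i) (t i) (u i))"

definition code1 :: "('a, 'm) ring_scheme \<Rightarrow> nat \<Rightarrow> nat \<Rightarrow>
    (nat \<Rightarrow> (nat \<Rightarrow> 'a) set) set \<Rightarrow> (nat \<Rightarrow> 'a) set" where
  "code1 F r n C = {s \<in> carrier (word_module F n).
     \<exists>t \<in> carrier (word_module F n). \<exists>u \<in> carrier (word_module F n). word_comb F r n s t u \<in> C}"

definition code2 :: "('a, 'm) ring_scheme \<Rightarrow> nat \<Rightarrow> nat \<Rightarrow>
    (nat \<Rightarrow> (nat \<Rightarrow> 'a) set) set \<Rightarrow> (nat \<Rightarrow> 'a) set" where
  "code2 F r n C = {t \<in> carrier (word_module F n).
     \<exists>s \<in> carrier (word_module F n). \<exists>u \<in> carrier (word_module F n). word_comb F r n s t u \<in> C}"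

definition code3 :: "('a, 'm) ring_scheme \<Rightarrow> nat \<Rightarrow> nat \<Rightarrow>
    (nat \<Rightarrow> (nat \<Rightarrow> 'a) set) set \<Rightarrow> (nat \<Rightarrow> 'a) set" where
  "code3 F r n C = {u \<in> carrier (word_module F n).
     \<exists>s \<in> carrier (word_module F n). \<exists>t \<in> carrier (word_module F n). word_comb F r n s t u \<in> C}"

text \<open>
  The polynomial \<open>e g(x)\<close> over \<open>R\<close>, for \<open>e\<close> in \<open>R\<close> and \<open>g\<close> over \<open>F\<close>; the constants \<open>F\<close> lie
  in \<open>R\<close> because the three idempotents sum to \<open>1\<close>.
\<close>

definition scaled_poly :: "('a, 'm) ring_scheme \<Rightarrow> nat \<Rightarrow>
    (nat \<Rightarrow> 'a) set \<Rightarrow> (nat \<Rightarrow> 'a) \<Rightarrow> (nat \<Rightarrow> (nat \<Rightarrow> 'a) set)" where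
  "scaled_poly F r e g = e \<odot>\<^bsub>UP (R_ring F r)\<^esub> (\<lambda>i. v_const F r (coeff (UP F) g i))"

end

theory Submission
  imports Defs "HOL-Algebra.Subrings" "HOL-Algebra.Multiplicative_Group"
begin

text \<open>
  The elements \<open>e\<^sub>1, e\<^sub>2, e\<^sub>3\<close> are nonzero orthogonal idempotents with sum \<open>1\<close>, so \<open>R\<close> is a copy
  of \<open>F \<times> F \<times> F\<close>. Multiplying a codeword by \<open>e\<^sub>i\<close> isolates its \<open>i\<close>-th component, hence \<open>C\<close> is
  in bijection with \<open>C\<^sub>1 \<times> C\<^sub>2 \<times> C\<^sub>3\<close>, and over the field \<open>C\<^sub>i\<close> consists of the multiples of \<open>g\<^sub>i\<close>
  of degree below \<open>n\<close>, of which there are \<open>|F|\<close> to the power \<open>n - deg g\<^sub>i\<close>. For the generators,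
  \<open>f \<mapsto> e\<^sub>i f\<close> sends \<open>F[x]\<close> to \<open>R[x]\<close> compatibly with reduction modulo \<open>x\<^sup>n - 1\<close>: it maps a congruence
  \<open>c \<equiv> h g\<^sub>i\<close> over \<open>F\<close> to one over \<open>R\<close>, so no division in \<open>R[x]\<close> is needed.
\<close>

section \<open>Words as residue classes of polynomials\<close>

lemma word_module_simps:
  "carrier (word_module A n) = {..<n} \<rightarrow>\<^sub>E carrier A"
  "c \<oplus>\<^bsub>word_module A n\<^esub> d = (\<lambda>i\<in>{..<n}. c i \<oplus>\<^bsub>A\<^esub> d i)"
  "\<zero>\<^bsub>word_module A n\<^esub> = (\<lambda>i\<in>{..<n}. \<zero>\<^bsub>A\<^esub>)"
  "a \<odot>\<^bsub>word_module A n\<^esub> c = (\<lambda>i\<in>{..<n}. a \<otimes>\<^bsub>A\<^esub> c i)"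
  by (simp_all add: word_module_def)

lemma cyclic_codeD:
  assumes "cyclic_code A n C"
  shows "C \<subseteq> {..<n} \<rightarrow>\<^sub>E carrier A"
    and "(\<lambda>i\<in>{..<n}. \<zero>\<^bsub>A\<^esub>) \<in> C"
    and "\<And>c d. c \<in> C \<Longrightarrow> d \<in> C \<Longrightarrow> (\<lambda>i\<in>{..<n}. c i \<oplus>\<^bsub>A\<^esub> d i) \<in> C"
    and "\<And>a c. a \<in> carrier A \<Longrightarrow> c \<in> C \<Longrightarrow> (\<lambda>i\<in>{..<n}. a \<otimes>\<^bsub>A\<^esub> c i) \<in> C"
    and "\<And>c. c \<in> C \<Longrightarrow> cyclic_shift n c \<in> C"
proof -
  interpret submodule C A "word_module A n"
    using assms by (simp add: cyclic_code_def)
  show "C \<subseteq> {..<n} \<rightarrow>\<^sub>E carrier A" "(\<lambda>i\<in>{..<n}. \<zero>\<^bsub>A\<^esub>) \<in> C"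
    using subset one_closed by (simp_all add: word_module_simps)
  show "(\<lambda>i\<in>{..<n}. c i \<oplus>\<^bsub>A\<^esub> d i) \<in> C" if "c \<in> C" "d \<in> C" for c d
    using m_closed[OF that] by (simp add: word_module_simps)
  show "(\<lambda>i\<in>{..<n}. a \<otimes>\<^bsub>A\<^esub> c i) \<in> C" if "a \<in> carrier A" "c \<in> C" for a c
    using smult_closed[OF that] by (simp add: word_module_simps)
  show "cyclic_shift n c \<in> C" if "c \<in> C" for c
    using assms that by (simp add: cyclic_code_def)
qed

context UP_ring
begin

text \<open>Every polynomial is a finite sum of monomials; the zero polynomial is covered as the
  monomial with coefficient zero.\<close>

lemma UP_induct [consumes 1, case_names add monom]:
  assumes "f \<in> carrier P"
    and add: "\<And>f g. \<lbrakk>f \<in> carrier P; g \<in> carrier P; Q f; Q g\<rbrakk> \<Longrightarrow> Q (f \<oplus>\<^bsub>P\<^esub> g)"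
    and monom: "\<And>a k. a \<in> carrier R \<Longrightarrow> Q (monom P a k)"
  shows "Q f"
proof -
  interpret P: ring P by (rule UP_ring)
  have "Q (\<Oplus>\<^bsub>P\<^esub>i\<in>A. monom P (coeff P f i) i)" if "finite A" for A
    using that
  proof induction
    case empty
    show ?case using monom[of \<zero> 0] by simp
  next
    case (insert k A)
    then show ?case
      using assms by (simp add: Pi_def)
  qed
  from this[of "{..deg R f}"] show ?thesis
    using assms(1) by (simp add: up_repr)
qed

lemma coeff_monom_one_mult:
  assumes "a \<in> carrier R" "f \<in> carrier P"
  shows "coeff P (monom P a 1 \<otimes>\<^bsub>P\<^esub> f) k = (if k = 0 then \<zero> else a \<otimes> coeff P f (k - 1))"
proof (cases k)
  case 0
  then show ?thesis using assms by simp
next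
  case (Suc m)
  then show ?thesis using coeff_monom_mult[OF assms, of 1 m] by (simp del: coeff_mult)
qed

end

context UP_cring
begin

lemma word_poly_closed: "c \<in> {..<n} \<rightarrow> carrier R \<Longrightarrow> word_poly R n c \<in> carrier P"
  unfolding word_poly_def P_def[symmetric] by (intro P.finsum_closed) (auto simp: Pi_def)

lemma coeff_word_poly:
  assumes "c \<in> {..<n} \<rightarrow> carrier R"
  shows "coeff P (word_poly R n c) k = (if k < n then c k else \<zero>)"
proof -
  have "coeff P (word_poly R n c) k = (\<Oplus>i\<in>{..<n}. if k = i then c i else \<zero>)"
    unfolding word_poly_def P_def[symmetric] using assms
    by (subst coeff_finsum) (auto simp: Pi_def intro!: R.finsum_cong')
  also have "\<dots> = (if k < n then c k else \<zero>)"
  proof (cases "k < n")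
    case True
    then show ?thesis using assms R.finsum_singleton[of k "{..<n}" c] by auto
  next
    case False
    then have "(\<Oplus>i\<in>{..<n}. if k = i then c i else \<zero>) = (\<Oplus>i\<in>{..<n}. \<zero>)"
      by (intro R.finsum_cong') auto
    then show ?thesis using False by simp
  qed
  finally show ?thesis .
qed

text \<open>Together with \<open>word_poly_inj\<close> this identifies the words of length
  \<open>n\<close> with the polynomials whose coefficients vanish from index \<open>n\<close>
  on.\<close>

lemma word_poly_coeff:
  assumes "f \<in> carrier P" "\<And>k. n \<le> k \<Longrightarrow> coeff P f k = \<zero>"
  shows "word_poly R n (\<lambda>i\<in>{..<n}. coeff P f i) = f"
  using assms by (intro up_eqI) (auto simp: coeff_word_poly word_poly_closed)

lemma word_poly_inj: "inj_on (word_poly R n) ({..<n} \<rightarrow>\<^sub>E carrier R)"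
proof (rule inj_onI)
  fix c d assume c: "c \<in> {..<n} \<rightarrow>\<^sub>E carrier R" and d: "d \<in> {..<n} \<rightarrow>\<^sub>E carrier R"
    and eq: "word_poly R n c = word_poly R n d"
  from c d have "c \<in> {..<n} \<rightarrow> carrier R" "d \<in> {..<n} \<rightarrow> carrier R" by auto
  then have "c i = d i" if "i < n" for i
    using that arg_cong[OF eq, of "\<lambda>f. coeff P f i"] by (simp add: coeff_word_poly)
  with c d show "c = d" by (intro PiE_ext) auto
qed

lemma word_poly_add:
  assumes "c \<in> {..<n} \<rightarrow> carrier R" "d \<in> {..<n} \<rightarrow> carrier R"
  shows "word_poly R n (\<lambda>i\<in>{..<n}. c i \<oplus> d i) = word_poly R n c \<oplus>\<^bsub>P\<^esub> word_poly R n d"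
proof -
  have "(\<lambda>i\<in>{..<n}. c i \<oplus> d i) \<in> {..<n} \<rightarrow> carrier R"
    using assms by auto
  with assms show ?thesis
    by (intro up_eqI) (auto simp: coeff_word_poly word_poly_closed)
qed

lemma word_poly_smult:
  assumes "a \<in> carrier R" "c \<in> {..<n} \<rightarrow> carrier R"
  shows "word_poly R n (\<lambda>i\<in>{..<n}. a \<otimes> c i) = a \<odot>\<^bsub>P\<^esub> word_poly R n c"
proof -
  have "(\<lambda>i\<in>{..<n}. a \<otimes> c i) \<in> {..<n} \<rightarrow> carrier R"
    using assms by auto
  with assms show ?thesis
    by (intro up_eqI) (auto simp: coeff_word_poly word_poly_closed)
qed

section \<open>Reduction modulo x^n - 1\<close>

lemma xn_minus_1_closed: "xn_minus_1 R n \<in> carrier P"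
  unfolding xn_minus_1_def P_def[symmetric] by simp

lemma coeff_xn_minus_1:
  "coeff P (xn_minus_1 R n) k = (if k = n then \<one> else \<zero>) \<ominus> (if k = 0 then \<one> else \<zero>)"
  unfolding xn_minus_1_def P_def[symmetric] by simp

text \<open>Multiplying by the indeterminate pushes the last letter to degree \<open>n\<close>,
  while the shift puts it at degree 0. The two results therefore differ by that letter times x^n -
  1.\<close>

lemma word_poly_cyclic_shift:
  assumes "n \<ge> 1" "c \<in> {..<n} \<rightarrow> carrier R"
  shows "monom P \<one> 1 \<otimes>\<^bsub>P\<^esub> word_poly R n c \<ominus>\<^bsub>P\<^esub> word_poly R n (cyclic_shift n c) =
    monom P (c (n - 1)) 0 \<otimes>\<^bsub>P\<^esub> xn_minus_1 R n"
proof -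
  have shift: "cyclic_shift n c \<in> {..<n} \<rightarrow> carrier R"
    using assms by (auto simp: cyclic_shift_def Pi_def)
  have last: "c (n - 1) \<in> carrier R" using assms by auto
  have c: "c i \<in> carrier R" if "i < n" for i using assms that by auto
  show ?thesis
  proof (rule up_eqI)
    fix k
    \<comment> \<open>The comparison splits at index 0, where the wrapped letter sits, and at index
      \<open>n\<close>, where the overflow sits.\<close>
    show "coeff P (monom P \<one> 1 \<otimes>\<^bsub>P\<^esub> word_poly R n c \<ominus>\<^bsub>P\<^esub> word_poly R n (cyclic_shift n c)) k =
      coeff P (monom P (c (n - 1)) 0 \<otimes>\<^bsub>P\<^esub> xn_minus_1 R n) k"
      using assms shift last c[of k] c[of "k - 1"]
      by (cases "k = 0"; cases "k < n"; cases "k = n")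
        (auto simp: coeff_minus coeff_monom_one_mult monom_mult_is_smult coeff_word_poly
          word_poly_closed coeff_xn_minus_1 xn_minus_1_closed cyclic_shift_def
          R.minus_eq R.r_neg R.r_minus simp del: coeff_mult One_nat_def)
  qed (use assms shift last in \<open>simp_all add: word_poly_closed xn_minus_1_closed\<close>)
qed

lemma ideal_xn_minus_1: "ideal (PIdl\<^bsub>P\<^esub> (xn_minus_1 R n)) P"
  by (rule P.cgenideal_ideal[OF xn_minus_1_closed])

lemma cring_cyclic_ring: "cring (cyclic_ring R n)"
  unfolding cyclic_ring_def P_def[symmetric]
  by (rule ideal.quotient_is_cring[OF ideal_xn_minus_1 P.is_cring])

lemma ring_hom_cyclic_class: "ring_hom_cring P (cyclic_ring R n) (cyclic_class R n)"
  unfolding cyclic_ring_def cyclic_class_def P_def[symmetric]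
  by (rule ideal.rcos_ring_hom_cring[OF ideal_xn_minus_1 P.is_cring])

lemma carrier_cyclic_ring: "carrier (cyclic_ring R n) = cyclic_class R n ` carrier P"
  unfolding cyclic_ring_def cyclic_class_def P_def[symmetric]
  by (auto simp: FactRing_simps)

lemma cyclic_class_eq_iff:
  assumes "f \<in> carrier P" "g \<in> carrier P"
  shows "cyclic_class R n f = cyclic_class R n g \<longleftrightarrow>
    (\<exists>h\<in>carrier P. f \<ominus>\<^bsub>P\<^esub> g = h \<otimes>\<^bsub>P\<^esub> xn_minus_1 R n)"
  using P.quotient_eq_iff_same_a_r_cos[OF ideal_xn_minus_1 assms, of n]
  unfolding cyclic_class_def P_def[symmetric] by (auto simp: cgenideal_def)

lemma cyclic_class_cyclic_shift:
  assumes "n \<ge> 1" "c \<in> {..<n} \<rightarrow> carrier R"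
  shows "cyclic_class R n (monom P \<one> 1 \<otimes>\<^bsub>P\<^esub> word_poly R n c) =
    cyclic_class R n (word_poly R n (cyclic_shift n c))"
proof -
  have "cyclic_shift n c \<in> {..<n} \<rightarrow> carrier R"
    using assms by (auto simp: cyclic_shift_def Pi_def)
  moreover have "c (n - 1) \<in> carrier R" using assms by auto
  ultimately show ?thesis
    using assms word_poly_cyclic_shift[OF assms]
    by (subst cyclic_class_eq_iff) (auto intro!: word_poly_closed simp del: One_nat_def)
qed

text \<open>Scaling is multiplication by a constant and the cyclic shift is multiplication by the
  indeterminate. Closure under both, together with sums, gives closure under every polynomial
  \<open>h\<close>.\<close>

lemma code_classes_mult_closed:
  assumes C: "cyclic_code R n C" and n: "n \<ge> 1" and "h \<in> carrier P" "x \<in> code_classes R n C"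
  shows "cyclic_class R n h \<otimes>\<^bsub>cyclic_ring R n\<^esub> x \<in> code_classes R n C"
proof -
  interpret H: ring_hom_cring P "cyclic_ring R n" "cyclic_class R n"
    by (rule ring_hom_cyclic_class)
  note C = cyclic_codeD[OF C]
  have word: "c \<in> {..<n} \<rightarrow> carrier R" if "c \<in> C" for c
    using C(1) that by auto
  from assms(3,4) show ?thesis
  proof (induction h arbitrary: x rule: UP_induct)
    case (add f g)
    from add.prems obtain c where c: "c \<in> C" "x = cyclic_class R n (word_poly R n c)"
      by (auto simp: code_classes_def)
    have x: "x \<in> carrier (cyclic_ring R n)"
      unfolding c using c by (auto intro!: H.hom_closed word_poly_closed word)
    from add obtain d e where d: "d \<in> C" "cyclic_class R n f \<otimes>\<^bsub>cyclic_ring R n\<^esub> x = cyclic_class R n (word_poly R n d)"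
      and e: "e \<in> C" "cyclic_class R n g \<otimes>\<^bsub>cyclic_ring R n\<^esub> x = cyclic_class R n (word_poly R n e)"
      unfolding code_classes_def by (smt (verit) imageE)
    have "cyclic_class R n (f \<oplus>\<^bsub>P\<^esub> g) \<otimes>\<^bsub>cyclic_ring R n\<^esub> x =
        cyclic_class R n (word_poly R n d) \<oplus>\<^bsub>cyclic_ring R n\<^esub> cyclic_class R n (word_poly R n e)"
      using add.hyps x d e by (simp add: H.S.l_distr)
    also have "\<dots> = cyclic_class R n (word_poly R n (\<lambda>i\<in>{..<n}. d i \<oplus> e i))"
      using d e by (simp add: word_poly_add word word_poly_closed)
    finally show ?case
      using C(3)[OF d(1) e(1)] by (simp add: code_classes_def)
  next
    case (monom a k)
    then show ?case
    \<comment> \<open>One power of the indeterminate is peeled off at a time and absorbed into the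
      codeword as a shift, so the class \<open>x\<close> has to vary in the induction.\<close>
    proof (induction k arbitrary: x)
      case 0
      from 0(2) obtain c where c: "c \<in> C" "x = cyclic_class R n (word_poly R n c)"
        by (auto simp: code_classes_def)
      have "cyclic_class R n (monom P a 0) \<otimes>\<^bsub>cyclic_ring R n\<^esub> x =
          cyclic_class R n (monom P a 0 \<otimes>\<^bsub>P\<^esub> word_poly R n c)"
        unfolding c using 0(1) word[OF c(1)] by (simp add: word_poly_closed)
      also have "\<dots> = cyclic_class R n (word_poly R n (\<lambda>i\<in>{..<n}. a \<otimes> c i))"
        using 0(1) word[OF c(1)] by (simp add: monom_mult_is_smult word_poly_closed word_poly_smult)
      finally show ?case
        using C(4)[OF 0(1) c(1)] by (simp add: code_classes_def)
    next
      case (Suc k)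
      from Suc(3) obtain c where c: "c \<in> C" "x = cyclic_class R n (word_poly R n c)"
        by (auto simp: code_classes_def)
      have "cyclic_class R n (monom P a (Suc k)) \<otimes>\<^bsub>cyclic_ring R n\<^esub> x =
          cyclic_class R n (monom P a k \<otimes>\<^bsub>P\<^esub> monom P \<one> 1 \<otimes>\<^bsub>P\<^esub> word_poly R n c)"
        unfolding c using Suc(2) word[OF c(1)] monom_mult[of a \<one> k 1]
        by (simp add: word_poly_closed del: monom_mult)
      also have "\<dots> = cyclic_class R n (monom P a k) \<otimes>\<^bsub>cyclic_ring R n\<^esub>
          cyclic_class R n (monom P \<one> 1 \<otimes>\<^bsub>P\<^esub> word_poly R n c)"
        using Suc(2) word[OF c(1)] by (simp add: P.m_assoc word_poly_closed H.S.m_assoc del: monom_mult)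
      also have "\<dots> \<in> code_classes R n C"
        unfolding cyclic_class_cyclic_shift[OF n word[OF c(1)]]
        by (rule Suc.IH[OF Suc(2)]) (use C(5)[OF c(1)] in \<open>simp add: code_classes_def\<close>)
      finally show ?case .
    qed
  qed
qed

lemma ideal_code_classes:
  assumes C: "cyclic_code R n C" and n: "n \<ge> 1"
  shows "ideal (code_classes R n C) (cyclic_ring R n)"
proof -
  interpret H: ring_hom_cring P "cyclic_ring R n" "cyclic_class R n"
    by (rule ring_hom_cyclic_class)
  note mult = code_classes_mult_closed[OF assms]
  note C = cyclic_codeD[OF C]
  have word: "c \<in> {..<n} \<rightarrow> carrier R" if "c \<in> C" for c
    using C(1) that by auto
  have closed: "x \<in> carrier (cyclic_ring R n)" if "x \<in> code_classes R n C" for x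
    using that by (auto simp: code_classes_def intro!: H.hom_closed word_poly_closed word)
  show ?thesis
  proof (rule idealI)
    show "subgroup (code_classes R n C) (add_monoid (cyclic_ring R n))"
    proof (rule H.S.add.subgroupI)
      show "code_classes R n C \<subseteq> carrier (cyclic_ring R n)" using closed by auto
      show "code_classes R n C \<noteq> {}" using C(2) by (auto simp: code_classes_def)
      fix x y assume x: "x \<in> code_classes R n C" and y: "y \<in> code_classes R n C"
      \<comment> \<open>Negation is multiplication by the class of -1, so \<open>mult\<close> covers
        it.\<close>
      have "\<ominus>\<^bsub>cyclic_ring R n\<^esub> x = cyclic_class R n (\<ominus>\<^bsub>P\<^esub> \<one>\<^bsub>P\<^esub>) \<otimes>\<^bsub>cyclic_ring R n\<^esub> x"
        using closed[OF x] by (simp add: H.S.l_minus)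
      with mult[of "\<ominus>\<^bsub>P\<^esub> \<one>\<^bsub>P\<^esub>" x] x show "\<ominus>\<^bsub>cyclic_ring R n\<^esub> x \<in> code_classes R n C" by simp
      from x y obtain c d where c: "c \<in> C" "x = cyclic_class R n (word_poly R n c)"
        and d: "d \<in> C" "y = cyclic_class R n (word_poly R n d)"
        by (auto simp: code_classes_def)
      then have "x \<oplus>\<^bsub>cyclic_ring R n\<^esub> y = cyclic_class R n (word_poly R n (\<lambda>i\<in>{..<n}. c i \<oplus> d i))"
        by (simp add: word_poly_add word word_poly_closed)
      then show "x \<oplus>\<^bsub>cyclic_ring R n\<^esub> y \<in> code_classes R n C"
        using C(3)[OF c(1) d(1)] by (simp add: code_classes_def)
    qed
  next
    fix a x assume a: "a \<in> code_classes R n C" and x: "x \<in> carrier (cyclic_ring R n)"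
    then obtain h where h: "h \<in> carrier P" "x = cyclic_class R n h"
      by (auto simp: carrier_cyclic_ring)
    with mult[OF h(1) a] show "x \<otimes>\<^bsub>cyclic_ring R n\<^esub> a \<in> code_classes R n C" by simp
    with x closed[OF a] show "a \<otimes>\<^bsub>cyclic_ring R n\<^esub> x \<in> code_classes R n C"
      by (simp add: H.S.m_comm)
  qed (rule H.S.ring_axioms)
qed

end

section \<open>Generator polynomials over a field\<close>

context UP_domain
begin

lemma xn_minus_1_nonzero:
  assumes "n \<ge> 1"
  shows "xn_minus_1 R n \<noteq> \<zero>\<^bsub>P\<^esub>"
proof
  assume "xn_minus_1 R n = \<zero>\<^bsub>P\<^esub>"
  with coeff_xn_minus_1[of n n] assms show False by (simp add: R.minus_eq)
qed

lemma deg_xn_minus_1: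
  assumes "n \<ge> 1"
  shows "deg R (xn_minus_1 R n) = n"
proof (rule le_antisym)
  show "deg R (xn_minus_1 R n) \<le> n"
    by (rule deg_aboveI) (simp_all add: coeff_xn_minus_1 xn_minus_1_closed R.minus_eq)
  show "n \<le> deg R (xn_minus_1 R n)"
    using assms by (intro deg_belowI) (simp_all add: coeff_xn_minus_1 xn_minus_1_closed R.minus_eq)
qed

text \<open>Degrees add over a domain, so a product supported below \<open>n\<close> leaves at most
  \<open>n - deg R g\<close> coefficients for \<open>f\<close>. Speaking of coefficients instead of
  degrees includes the case of \<open>f\<close> being zero.\<close>

lemma deg_mult_lessD:
  assumes "f \<in> carrier P" "g \<in> carrier P" "g \<noteq> \<zero>\<^bsub>P\<^esub>" "\<And>k. n \<le> k \<Longrightarrow> coeff P (f \<otimes>\<^bsub>P\<^esub> g) k = \<zero>"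
    and "deg R g \<le> n" "n - deg R g \<le> k"
  shows "coeff P f k = \<zero>"
proof (cases "f = \<zero>\<^bsub>P\<^esub>")
  case False
  then have fg: "f \<otimes>\<^bsub>P\<^esub> g \<noteq> \<zero>\<^bsub>P\<^esub>" using assms UP_integral by blast
  have "deg R f + deg R g < n"
  proof (rule ccontr)
    assume "\<not> ?thesis"
    \<comment> \<open>The leading coefficient of the product would sit at an index of at least
      \<open>n\<close>.\<close>
    then have "coeff P (f \<otimes>\<^bsub>P\<^esub> g) (deg R (f \<otimes>\<^bsub>P\<^esub> g)) = \<zero>"
      using assms False by (intro assms(4)) simp
    with fg assms show False using lcoeff_nonzero2[of "f \<otimes>\<^bsub>P\<^esub> g"] by (simp del: coeff_mult)
  qed
  with assms show ?thesis by (intro deg_aboveD) auto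
qed simp

text \<open>Two words of length \<open>n\<close> in the same class differ by a multiple of x^n - 1
  supported below \<open>n\<close>, and only the zero multiple is that short.\<close>

lemma cyclic_class_word_poly_inj:
  assumes "n \<ge> 1"
  shows "inj_on (\<lambda>c. cyclic_class R n (word_poly R n c)) ({..<n} \<rightarrow>\<^sub>E carrier R)"
proof (rule inj_onI)
  fix c d assume c: "c \<in> {..<n} \<rightarrow>\<^sub>E carrier R" and d: "d \<in> {..<n} \<rightarrow>\<^sub>E carrier R"
    and eq: "cyclic_class R n (word_poly R n c) = cyclic_class R n (word_poly R n d)"
  from c d have cd: "c \<in> {..<n} \<rightarrow> carrier R" "d \<in> {..<n} \<rightarrow> carrier R" by auto
  note closed = word_poly_closed[OF cd(1)] word_poly_closed[OF cd(2)]
  obtain h where h: "h \<in> carrier P"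
      "word_poly R n c \<ominus>\<^bsub>P\<^esub> word_poly R n d = h \<otimes>\<^bsub>P\<^esub> xn_minus_1 R n"
    using eq closed by (auto simp: cyclic_class_eq_iff)
  have "coeff P h k = \<zero>" for k
  \<comment> \<open>The degree of the modulus equals the bound \<open>n\<close>, so the claim starts
    at index 0 and every coefficient of \<open>h\<close> vanishes.\<close>
  proof (rule deg_mult_lessD[OF h(1) xn_minus_1_closed xn_minus_1_nonzero[OF assms]])
    show "coeff P (h \<otimes>\<^bsub>P\<^esub> xn_minus_1 R n) i = \<zero>" if "n \<le> i" for i
      unfolding h(2)[symmetric] using closed cd that
      by (simp add: coeff_minus coeff_word_poly R.minus_eq)
  qed (simp_all only: deg_xn_minus_1[OF assms] order_refl diff_self_eq_0 le0)
  then have "h = \<zero>\<^bsub>P\<^esub>" using h by (intro up_eqI) simp_all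
  then have "word_poly R n c = word_poly R n d"
    using h closed by (simp add: xn_minus_1_closed)
  with word_poly_inj c d show "c = d" by (auto dest: inj_onD)
qed

lemma generator_poly_nonzero:
  assumes "generator_poly R n D g"
  shows "g \<noteq> \<zero>\<^bsub>P\<^esub>"
proof
  assume "g = \<zero>\<^bsub>P\<^esub>"
  with assms show False by (simp add: generator_poly_def P_def[symmetric])
qed

text \<open>\<open>g\<close> is a factor of x^n - 1 and degrees add. The bound makes
  \<open>n - deg R g\<close> a true difference.\<close>

lemma deg_generator_poly_le:
  assumes "generator_poly R n D g" "n \<ge> 1"
  shows "deg R g \<le> n"
proof -
  from assms(1) obtain f where g: "g \<in> carrier P" and f: "f \<in> carrier P"
    and eq: "xn_minus_1 R n = g \<otimes>\<^bsub>P\<^esub> f"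
    by (auto simp: generator_poly_def P_def[symmetric] factor_def)
  with xn_minus_1_nonzero[OF assms(2)] have "f \<noteq> \<zero>\<^bsub>P\<^esub>" by auto
  then have "n = deg R g + deg R f"
    using deg_mult[OF generator_poly_nonzero[OF assms(1)] _ g f] deg_xn_minus_1[OF assms(2)] eq
    by simp
  then show ?thesis by simp
qed

text \<open>Since \<open>g\<close> divides x^n - 1, a congruence to a multiple of \<open>g\<close>
  modulo x^n - 1 is the same as plain divisibility by \<open>g\<close> in the polynomial
  ring.\<close>

lemma generator_poly_code:
  assumes g: "generator_poly R n D g" and n: "n \<ge> 1" and D: "D \<subseteq> {..<n} \<rightarrow>\<^sub>E carrier R"
  shows "D = {c \<in> {..<n} \<rightarrow>\<^sub>E carrier R. g divides\<^bsub>P\<^esub> word_poly R n c}"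
proof (intro subset_antisym subsetI CollectI conjI)
  interpret H: ring_hom_cring P "cyclic_ring R n" "cyclic_class R n"
    by (rule ring_hom_cyclic_class)
  have g': "g \<in> carrier P" "g divides\<^bsub>P\<^esub> xn_minus_1 R n"
    and classes: "code_classes R n D = PIdl\<^bsub>cyclic_ring R n\<^esub> (cyclic_class R n g)"
    using g by (simp_all add: generator_poly_def P_def[symmetric])
  {
    fix c assume c: "c \<in> D"
    with D show cD: "c \<in> {..<n} \<rightarrow>\<^sub>E carrier R" by auto
    then have closed: "word_poly R n c \<in> carrier P" by (intro word_poly_closed) auto
    from c have "cyclic_class R n (word_poly R n c) \<in> PIdl\<^bsub>cyclic_ring R n\<^esub> (cyclic_class R n g)"
      using classes by (auto simp: code_classes_def)
    then obtain f where f: "f \<in> carrier P"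
      and "cyclic_class R n (word_poly R n c) = cyclic_class R n (f \<otimes>\<^bsub>P\<^esub> g)"
      using g' by (auto simp: cgenideal_def carrier_cyclic_ring)
    then obtain h where h: "h \<in> carrier P"
      and "word_poly R n c \<ominus>\<^bsub>P\<^esub> f \<otimes>\<^bsub>P\<^esub> g = h \<otimes>\<^bsub>P\<^esub> xn_minus_1 R n"
      using cyclic_class_eq_iff[OF closed P.m_closed[OF f g'(1)]] by auto
    moreover from g'(2) obtain q where q: "q \<in> carrier P" "xn_minus_1 R n = g \<otimes>\<^bsub>P\<^esub> q"
      by (auto simp: factor_def)
    ultimately have "word_poly R n c \<ominus>\<^bsub>P\<^esub> f \<otimes>\<^bsub>P\<^esub> g = h \<otimes>\<^bsub>P\<^esub> (g \<otimes>\<^bsub>P\<^esub> q)"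
      by simp
    then have "word_poly R n c = h \<otimes>\<^bsub>P\<^esub> (g \<otimes>\<^bsub>P\<^esub> q) \<oplus>\<^bsub>P\<^esub> f \<otimes>\<^bsub>P\<^esub> g"
      using closed f g' h q by (metis P.add.inv_solve_right P.m_closed P.minus_eq)
    also have "\<dots> = g \<otimes>\<^bsub>P\<^esub> (h \<otimes>\<^bsub>P\<^esub> q \<oplus>\<^bsub>P\<^esub> f)"
      using f g' h q by (simp add: P.r_distr P.m_ac)
    finally show "g divides\<^bsub>P\<^esub> word_poly R n c"
      using f h q by (auto simp: factor_def)
  next
    fix c assume "c \<in> {c \<in> {..<n} \<rightarrow>\<^sub>E carrier R. g divides\<^bsub>P\<^esub> word_poly R n c}"
    then obtain f where c: "c \<in> {..<n} \<rightarrow>\<^sub>E carrier R" and f: "f \<in> carrier P"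
      and eq: "word_poly R n c = f \<otimes>\<^bsub>P\<^esub> g"
      using g' by (auto simp: factor_def P.m_comm)
    \<comment> \<open>The multiple of \<open>g\<close> shares its class with some codeword, and
      injectivity of the class map on words makes it that codeword.\<close>
    have "cyclic_class R n (word_poly R n c) \<in> code_classes R n D"
      unfolding classes cgenideal_def eq using f g' by auto
    then obtain d where "d \<in> D"
      and "cyclic_class R n (word_poly R n c) = cyclic_class R n (word_poly R n d)"
      by (auto simp: code_classes_def)
    with cyclic_class_word_poly_inj[OF n] c D show "c \<in> D"
      by (auto dest: inj_onD)
  }
qed

text \<open>Multiplication by \<open>g\<close> matches the words of length \<open>n - deg g\<close> with the codewords.\<close>

lemma card_generator_poly_code:
  assumes g: "generator_poly R n D g" and n: "n \<ge> 1" and D: "D \<subseteq> {..<n} \<rightarrow>\<^sub>E carrier R"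
  shows "card D = card (carrier R) ^ (n - deg R g)"
proof -
  let ?m = "n - deg R g"
  let ?W = "{..<?m} \<rightarrow>\<^sub>E carrier R"
  let ?f = "\<lambda>c. \<lambda>i\<in>{..<n}. coeff P (word_poly R ?m c \<otimes>\<^bsub>P\<^esub> g) i"
  have g': "g \<in> carrier P" using g by (simp add: generator_poly_def P_def[symmetric])
  note g0 = generator_poly_nonzero[OF g]
  note degg = deg_generator_poly_le[OF g n]
  have W: "c \<in> {..<?m} \<rightarrow> carrier R" if "c \<in> ?W" for c using that by auto
  have fW: "?f c \<in> {..<n} \<rightarrow>\<^sub>E carrier R" if "c \<in> ?W" for c
    using W[OF that] g' by (auto simp: word_poly_closed simp del: coeff_mult)
  \<comment> \<open>If nonzero, the first factor has degree below \<open>?m\<close>, so the product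
    has degree below \<open>n\<close> and cutting it to \<open>n\<close> coefficients loses
    nothing.\<close>
  have poly: "word_poly R n (?f c) = word_poly R ?m c \<otimes>\<^bsub>P\<^esub> g" if c: "c \<in> ?W" for c
  proof (rule word_poly_coeff)
    fix k assume k: "n \<le> k"
    show "coeff P (word_poly R ?m c \<otimes>\<^bsub>P\<^esub> g) k = \<zero>"
    proof (cases "word_poly R ?m c = \<zero>\<^bsub>P\<^esub>")
      case False
      have "deg R (word_poly R ?m c) < ?m"
      proof (rule ccontr)
        assume "\<not> ?thesis"
        then have "coeff P (word_poly R ?m c) (deg R (word_poly R ?m c)) = \<zero>"
          using W[OF c] by (simp add: coeff_word_poly)
        with False lcoeff_nonzero2 word_poly_closed W[OF c] show False by blast
      qed
      with k degg show ?thesis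
        using deg_mult[OF False g0 word_poly_closed[OF W[OF c]] g'] W[OF c] g'
        by (intro deg_aboveD) (auto simp: word_poly_closed)
    qed (use g' in \<open>simp del: coeff_mult\<close>)
  qed (use W[OF c] g' in \<open>simp add: word_poly_closed\<close>)
  have "bij_betw ?f ?W D"
  proof (rule bij_betw_imageI)
    show "inj_on ?f ?W"
    proof (rule inj_onI)
      fix c d assume c: "c \<in> ?W" and d: "d \<in> ?W" and eq: "?f c = ?f d"
      then have "word_poly R ?m c \<otimes>\<^bsub>P\<^esub> g = word_poly R ?m d \<otimes>\<^bsub>P\<^esub> g"
        using poly by metis
      then have "word_poly R ?m c = word_poly R ?m d"
        using g0 g' W c d by (simp add: domain.m_rcancel[OF UP_domain] word_poly_closed)
      with word_poly_inj c d show "c = d" by (auto dest: inj_onD)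
    qed
    show "?f ` ?W = D"
    proof (intro subset_antisym subsetI)
      fix d assume "d \<in> ?f ` ?W"
      then obtain c where c: "c \<in> ?W" "d = ?f c" by auto
      have "g divides\<^bsub>P\<^esub> word_poly R n (?f c)"
        unfolding poly[OF c(1)] factor_def using word_poly_closed[OF W[OF c(1)]] P.m_comm[OF _ g']
        by blast
      then show "d \<in> D"
        unfolding generator_poly_code[OF assms] c(2) using fW[OF c(1)] by simp
    next
      fix d assume "d \<in> D"
      then have d: "d \<in> {..<n} \<rightarrow>\<^sub>E carrier R" and "g divides\<^bsub>P\<^esub> word_poly R n d"
        using generator_poly_code[OF assms] by auto
      then obtain h where h: "h \<in> carrier P" "word_poly R n d = h \<otimes>\<^bsub>P\<^esub> g"
        using g' by (auto simp: factor_def P.m_comm)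
      have d': "d \<in> {..<n} \<rightarrow> carrier R" using d by auto
      \<comment> \<open>The quotient by \<open>g\<close> fits into \<open>?m\<close> coefficients,
        hence comes from a word of that length.\<close>
      have "coeff P h k = \<zero>" if "?m \<le> k" for k
      proof (rule deg_mult_lessD[OF h(1) g' g0 _ degg that])
        show "coeff P (h \<otimes>\<^bsub>P\<^esub> g) i = \<zero>" if "n \<le> i" for i
          using that d' by (simp add: h(2)[symmetric] coeff_word_poly del: coeff_mult)
      qed
      then have "word_poly R ?m (\<lambda>i\<in>{..<?m}. coeff P h i) = h"
        using h by (intro word_poly_coeff)
      moreover have cW: "(\<lambda>i\<in>{..<?m}. coeff P h i) \<in> ?W" using h by auto
      ultimately have "word_poly R n (?f (\<lambda>i\<in>{..<?m}. coeff P h i)) = word_poly R n d"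
        using poly h by metis
      then have "?f (\<lambda>i\<in>{..<?m}. coeff P h i) = d"
        by (rule inj_onD[OF word_poly_inj _ fW[OF cW] d])
      with cW show "d \<in> ?f ` ?W" by blast
    qed
  qed
  then have "card D = card ?W" by (simp add: bij_betw_same_card)
  also have "\<dots> = card (carrier R) ^ ?m" by (simp add: card_PiE)
  finally show ?thesis .
qed

end

section \<open>Coefficientwise extension of a ring homomorphism\<close>

context ring_hom_cring
begin

text \<open>\<open>h\<close> sends zero to zero, so an index bound on the support of
  \<open>f\<close> also bounds the support of the image.\<close>

lemma coeff_map_UP:
  assumes "f \<in> carrier (UP R)"
  shows "(\<lambda>i. h (coeff (UP R) f i)) \<in> carrier (UP S)"
    and "coeff (UP S) (\<lambda>i. h (coeff (UP R) f i)) = (\<lambda>i. h (coeff (UP R) f i))"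
proof -
  interpret UP_cring R "UP R" by unfold_locales
  have "f \<in> up R" using assms by (simp add: UP_def)
  then obtain n where "bound \<zero> n f" by (auto dest: R.bound_upD)
  with assms have "bound \<zero>\<^bsub>S\<^esub> n (\<lambda>i. h (coeff (UP R) f i))"
    by (auto simp: bound_def UP_def)
  with assms have "(\<lambda>i. h (coeff (UP R) f i)) \<in> up S"
    by (intro mem_upI) auto
  then show "(\<lambda>i. h (coeff (UP R) f i)) \<in> carrier (UP S)"
    "coeff (UP S) (\<lambda>i. h (coeff (UP R) f i)) = (\<lambda>i. h (coeff (UP R) f i))"
    by (auto simp: UP_def)
qed

text \<open>Coefficients of a product are finite sums of products of coefficients, and
  \<open>h\<close> preserves these.\<close>

lemma ring_hom_map_UP: "ring_hom_cring (UP R) (UP S) (\<lambda>f i. h (coeff (UP R) f i))"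
proof -
  interpret UR: UP_cring R "UP R" by unfold_locales
  interpret US: UP_cring S "UP S" by unfold_locales
  show ?thesis
  proof (intro ring_hom_cringI UR.P.is_cring US.P.is_cring ring_hom_memI)
    fix f g assume fg: "f \<in> carrier (UP R)" "g \<in> carrier (UP R)"
    then show "(\<lambda>i. h (coeff (UP R) (f \<otimes>\<^bsub>UP R\<^esub> g) i)) =
        (\<lambda>i. h (coeff (UP R) f i)) \<otimes>\<^bsub>UP S\<^esub> (\<lambda>i. h (coeff (UP R) g i))"
      using coeff_map_UP[of "f \<otimes>\<^bsub>UP R\<^esub> g"] coeff_map_UP[OF fg(1)] coeff_map_UP[OF fg(2)]
      by (intro US.up_eqI) (simp_all add: Pi_def comp_def)
    show "(\<lambda>i. h (coeff (UP R) (f \<oplus>\<^bsub>UP R\<^esub> g) i)) =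
        (\<lambda>i. h (coeff (UP R) f i)) \<oplus>\<^bsub>UP S\<^esub> (\<lambda>i. h (coeff (UP R) g i))"
      using fg coeff_map_UP[of "f \<oplus>\<^bsub>UP R\<^esub> g"] coeff_map_UP[OF fg(1)] coeff_map_UP[OF fg(2)]
      by (intro US.up_eqI) simp_all
  next
    show "(\<lambda>i. h (coeff (UP R) \<one>\<^bsub>UP R\<^esub> i)) = \<one>\<^bsub>UP S\<^esub>"
      using coeff_map_UP[of "\<one>\<^bsub>UP R\<^esub>"] by (intro US.up_eqI) simp_all
  qed (rule coeff_map_UP)
qed

lemma map_xn_minus_1:
  "(\<lambda>i. h (coeff (UP R) (xn_minus_1 R n) i)) = xn_minus_1 S n"
proof -
  interpret UR: UP_cring R "UP R" by unfold_locales
  interpret US: UP_cring S "UP S" by unfold_locales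
  show ?thesis
    using coeff_map_UP[OF UR.xn_minus_1_closed[of n]]
    by (intro US.up_eqI)
      (auto simp: UR.coeff_xn_minus_1 US.coeff_xn_minus_1 US.xn_minus_1_closed R.minus_eq S.minus_eq)
qed

lemma scaled_map_word_poly:
  assumes "e \<in> carrier S" "s \<in> {..<n} \<rightarrow> carrier R"
  shows "e \<odot>\<^bsub>UP S\<^esub> (\<lambda>i. h (coeff (UP R) (word_poly R n s) i)) =
    word_poly S n (\<lambda>i\<in>{..<n}. e \<otimes>\<^bsub>S\<^esub> h (s i))"
proof -
  interpret UR: UP_cring R "UP R" by unfold_locales
  interpret US: UP_cring S "UP S" by unfold_locales
  have es: "(\<lambda>i\<in>{..<n}. e \<otimes>\<^bsub>S\<^esub> h (s i)) \<in> {..<n} \<rightarrow> carrier S"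
    using assms by auto
  show ?thesis
    using assms es coeff_map_UP[OF UR.word_poly_closed[OF assms(2)]]
    by (intro US.up_eqI) (auto simp: UR.coeff_word_poly US.coeff_word_poly US.word_poly_closed)
qed

text \<open>The coefficientwise map fixes x^n - 1. Applying it to f - g = q (x^n - 1) and scaling by
  \<open>e\<close> turns the witness \<open>q\<close> into \<open>e\<close> times its image.\<close>

lemma cyclic_class_scaled_map_eq:
  assumes e: "e \<in> carrier S" and f: "f \<in> carrier (UP R)" and g: "g \<in> carrier (UP R)"
    and eq: "cyclic_class R n f = cyclic_class R n g"
  shows "cyclic_class S n (e \<odot>\<^bsub>UP S\<^esub> (\<lambda>i. h (coeff (UP R) f i))) =
    cyclic_class S n (e \<odot>\<^bsub>UP S\<^esub> (\<lambda>i. h (coeff (UP R) g i)))"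
proof -
  interpret UR: UP_cring R "UP R" by unfold_locales
  interpret US: UP_cring S "UP S" by unfold_locales
  interpret M: ring_hom_cring "UP R" "UP S" "\<lambda>f i. h (coeff (UP R) f i)"
    by (rule ring_hom_map_UP)
  let ?M = "\<lambda>f i. h (coeff (UP R) f i)"
  obtain q where q: "q \<in> carrier (UP R)" "f \<ominus>\<^bsub>UP R\<^esub> g = q \<otimes>\<^bsub>UP R\<^esub> xn_minus_1 R n"
    using eq f g by (auto simp: UR.cyclic_class_eq_iff)
  note closed = coeff_map_UP(1)[OF f] coeff_map_UP(1)[OF g] coeff_map_UP(1)[OF q(1)]
  have "?M f \<ominus>\<^bsub>UP S\<^esub> ?M g = ?M (f \<ominus>\<^bsub>UP R\<^esub> g)"
    using f g by (simp only: UR.P.minus_eq US.P.minus_eq M.hom_add M.hom_a_inv UR.P.a_inv_closed)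
  also have "\<dots> = ?M q \<otimes>\<^bsub>UP S\<^esub> xn_minus_1 S n"
    unfolding q(2) M.hom_mult[OF q(1) UR.xn_minus_1_closed] map_xn_minus_1 ..
  finally have *: "?M f \<ominus>\<^bsub>UP S\<^esub> ?M g = ?M q \<otimes>\<^bsub>UP S\<^esub> xn_minus_1 S n" .
  have "e \<odot>\<^bsub>UP S\<^esub> ?M f \<ominus>\<^bsub>UP S\<^esub> e \<odot>\<^bsub>UP S\<^esub> ?M g = e \<odot>\<^bsub>UP S\<^esub> (?M f \<ominus>\<^bsub>UP S\<^esub> ?M g)"
    using e closed by (simp add: US.P.minus_eq US.smult_r_distr US.smult_r_minus)
  also have "\<dots> = (e \<odot>\<^bsub>UP S\<^esub> ?M q) \<otimes>\<^bsub>UP S\<^esub> xn_minus_1 S n"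
    unfolding * using e closed by (simp add: US.UP_smult_assoc2 US.xn_minus_1_closed)
  finally have "\<exists>q\<in>carrier (UP S). e \<odot>\<^bsub>UP S\<^esub> ?M f \<ominus>\<^bsub>UP S\<^esub> e \<odot>\<^bsub>UP S\<^esub> ?M g = q \<otimes>\<^bsub>UP S\<^esub> xn_minus_1 S n"
    using e closed by blast
  then show ?thesis
    using e closed by (subst US.cyclic_class_eq_iff) auto
qed

text \<open>For the zero code \<open>g\<close> has degree \<open>n\<close>, so it need not be the
  polynomial of a word. A codeword \<open>s\<close> in the same class takes its place.\<close>

lemma scaled_generator_mem:
  assumes e: "e \<in> carrier S" and g: "generator_poly R n D g"
    and D: "D \<subseteq> {..<n} \<rightarrow>\<^sub>E carrier R"
    and C: "\<And>s. s \<in> D \<Longrightarrow> (\<lambda>i\<in>{..<n}. e \<otimes>\<^bsub>S\<^esub> h (s i)) \<in> C"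
  shows "cyclic_class S n (e \<odot>\<^bsub>UP S\<^esub> (\<lambda>i. h (coeff (UP R) g i))) \<in> code_classes S n C"
proof -
  interpret UR: UP_cring R "UP R" by unfold_locales
  interpret H: ring_hom_cring "UP R" "cyclic_ring R n" "cyclic_class R n"
    by (rule UR.ring_hom_cyclic_class)
  have g': "g \<in> carrier (UP R)" using g by (simp add: generator_poly_def)
  then have "cyclic_class R n g \<in> code_classes R n D"
    using g H.S.cgenideal_self by (simp add: generator_poly_def)
  then obtain s where s: "s \<in> D" "cyclic_class R n g = cyclic_class R n (word_poly R n s)"
    by (auto simp: code_classes_def)
  then have s': "s \<in> {..<n} \<rightarrow> carrier R" using D by auto
  from cyclic_class_scaled_map_eq[OF e g' UR.word_poly_closed[OF s'] s(2)]
  show ?thesis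
    using C[OF s(1)] scaled_map_word_poly[OF e s'] by (simp add: code_classes_def)
qed

text \<open>A codeword is congruent to some f g over \<open>R\<close>. Its scaled image is then
  congruent to the image of \<open>f\<close> times the scaled image of \<open>g\<close>, a product
  that the ideal \<open>J\<close> absorbs.\<close>

lemma scaled_word_mem:
  assumes e: "e \<in> carrier S" and g: "generator_poly R n D g"
    and D: "D \<subseteq> {..<n} \<rightarrow>\<^sub>E carrier R" and J: "ideal J (cyclic_ring S n)"
    and gJ: "cyclic_class S n (e \<odot>\<^bsub>UP S\<^esub> (\<lambda>i. h (coeff (UP R) g i))) \<in> J" and s: "s \<in> D"
  shows "cyclic_class S n (word_poly S n (\<lambda>i\<in>{..<n}. e \<otimes>\<^bsub>S\<^esub> h (s i))) \<in> J"
proof -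
  interpret UR: UP_cring R "UP R" by unfold_locales
  interpret US: UP_cring S "UP S" by unfold_locales
  interpret H: ring_hom_cring "UP R" "cyclic_ring R n" "cyclic_class R n"
    by (rule UR.ring_hom_cyclic_class)
  interpret K: ring_hom_cring "UP S" "cyclic_ring S n" "cyclic_class S n"
    by (rule US.ring_hom_cyclic_class)
  interpret M: ring_hom_cring "UP R" "UP S" "\<lambda>f i. h (coeff (UP R) f i)"
    by (rule ring_hom_map_UP)
  let ?M = "\<lambda>f i. h (coeff (UP R) f i)"
  have s': "s \<in> {..<n} \<rightarrow> carrier R" using D s by auto
  have g': "g \<in> carrier (UP R)" using g by (simp add: generator_poly_def)
  have "cyclic_class R n (word_poly R n s) \<in> PIdl\<^bsub>cyclic_ring R n\<^esub> (cyclic_class R n g)"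
    using g s by (auto simp: generator_poly_def code_classes_def)
  then obtain f where f: "f \<in> carrier (UP R)"
    and eq: "cyclic_class R n (word_poly R n s) = cyclic_class R n (f \<otimes>\<^bsub>UP R\<^esub> g)"
    using g' by (auto simp: cgenideal_def UR.carrier_cyclic_ring)
  note closed = coeff_map_UP(1)[OF f] coeff_map_UP(1)[OF g']
  have "cyclic_class S n (word_poly S n (\<lambda>i\<in>{..<n}. e \<otimes>\<^bsub>S\<^esub> h (s i))) =
      cyclic_class S n (e \<odot>\<^bsub>UP S\<^esub> ?M (f \<otimes>\<^bsub>UP R\<^esub> g))"
    unfolding scaled_map_word_poly[OF e s', symmetric]
    by (rule cyclic_class_scaled_map_eq[OF e UR.word_poly_closed[OF s'] _ eq]) (use f g' in simp)
  also have "e \<odot>\<^bsub>UP S\<^esub> ?M (f \<otimes>\<^bsub>UP R\<^esub> g) = ?M f \<otimes>\<^bsub>UP S\<^esub> (e \<odot>\<^bsub>UP S\<^esub> ?M g)"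
    unfolding M.hom_mult[OF f g'] using e closed
    by (metis US.P.m_comm US.UP_smult_assoc2 US.UP_smult_closed)
  also have "cyclic_class S n \<dots> = cyclic_class S n (?M f) \<otimes>\<^bsub>cyclic_ring S n\<^esub> cyclic_class S n (e \<odot>\<^bsub>UP S\<^esub> ?M g)"
    using e closed by (intro K.hom_mult) auto
  also have "\<dots> \<in> J"
    by (rule ideal.I_l_closed[OF J gJ]) (rule K.hom_closed[OF closed(1)])
  finally show ?thesis .
qed

end

section \<open>The idempotents\<close>

text \<open>
  Multiplication by \<open>v\<close> permutes \<open>v, \<dots>, v\<^sup>r\<close> cyclically, so their sum \<open>S\<close> satisfies
  \<open>v S = S\<close> and therefore \<open>S\<^sup>2 = r S\<close>.
\<close>

lemma (in cring) orthogonal_idempotents: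
  fixes r :: nat
  assumes v: "v \<in> carrier R" "v [^] (r + 1) = v" and r: "r \<ge> 1"
    and c: "c \<in> carrier R" "c \<otimes> ([r] \<cdot> \<one>) = \<one>"
  defines "w \<equiv> v [^] r"
  defines "E1 \<equiv> c \<otimes> (\<Oplus>i\<in>{1..r}. v [^] i)"
  defines "E2 \<equiv> w \<ominus> E1"
  defines "E3 \<equiv> \<one> \<ominus> w"
  shows "E1 \<otimes> E1 = E1" "E2 \<otimes> E2 = E2" "E3 \<otimes> E3 = E3"
    "E1 \<otimes> E2 = \<zero>" "E1 \<otimes> E3 = \<zero>" "E2 \<otimes> E3 = \<zero>"
    "E1 \<oplus> E2 \<oplus> E3 = \<one>"
proof -
  define S where "S = (\<Oplus>i\<in>{1..r}. v [^] i)"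
  have S: "S \<in> carrier R" unfolding S_def using v(1) by (auto intro!: finsum_closed)
  have w: "w \<in> carrier R" using v(1) by (simp add: w_def)
  have E1: "E1 = c \<otimes> S" by (simp add: E1_def S_def)
  then have E1c: "E1 \<in> carrier R" using c S by simp
  \<comment> \<open>Both sides are the sum of the powers of \<open>v\<close> from 1 to m + 1; the
    extra \<open>v\<close> on the left avoids a subtraction.\<close>
  have "v \<otimes> (\<Oplus>i\<in>{1..m}. v [^] i) \<oplus> v = (\<Oplus>i\<in>{1..m}. v [^] i) \<oplus> v [^] Suc m" for m
  proof (induction m)
    case (Suc m)
    let ?T = "\<Oplus>i\<in>{1..m}. v [^] i"
    have T: "?T \<in> carrier R" using v(1) by (auto intro!: finsum_closed)
    let ?x = "v [^] Suc m" and ?y = "v [^] Suc (Suc m)"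
    have xy: "?x \<in> carrier R" "?y \<in> carrier R" using v(1) by (simp_all del: nat_pow_Suc)
    have T': "(\<Oplus>i\<in>{1..Suc m}. v [^] i) = ?x \<oplus> ?T"
      using v(1) by (simp add: atLeastAtMostSuc_conv Pi_def del: nat_pow_Suc)
    have "v \<otimes> ?x = ?y"
      using v(1) by (simp add: m_comm)
    then have "v \<otimes> (?x \<oplus> ?T) \<oplus> v = ?y \<oplus> (v \<otimes> ?T \<oplus> v)"
      using v(1) T xy by (simp add: r_distr a_assoc del: nat_pow_Suc)
    also have "\<dots> = (?x \<oplus> ?T) \<oplus> ?y"
      unfolding Suc using T xy by (simp add: a_ac del: nat_pow_Suc)
    finally show ?case unfolding T' .
  qed (use v(1) in simp)
  \<comment> \<open>For m = r the extra power on the right is \<open>v\<close> again, and cancelling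
    it gives v S = S.\<close>
  from this[of r] have "v \<otimes> S \<oplus> v = S \<oplus> v"
    unfolding S_def[symmetric] Suc_eq_plus1 v(2) .
  then have "v \<otimes> S = S"
    using v(1) S by (simp add: add.r_cancel)
  then have vS: "v [^] i \<otimes> S = S" for i :: nat
  proof (induction i)
    case (Suc i)
    then show ?case using v(1) S by (simp add: m_assoc)
  qed (use S in simp)
  have "S \<otimes> S = (\<Oplus>i\<in>{1..r}. v [^] i \<otimes> S)"
    unfolding S_def using v(1) by (intro finsum_ldistr) (auto intro!: finsum_closed)
  also have "\<dots> = [r] \<cdot> S" using S by (simp add: vS add.finprod_const)
  also have "\<dots> = ([r] \<cdot> \<one>) \<otimes> S" using S by (simp add: add_pow_ldistr)
  finally have SS: "S \<otimes> S = ([r] \<cdot> \<one>) \<otimes> S" .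
  have "E1 \<otimes> E1 = c \<otimes> (c \<otimes> (S \<otimes> S))"
    unfolding E1 using c S by (simp add: m_ac)
  also have "\<dots> = c \<otimes> ((c \<otimes> ([r] \<cdot> \<one>)) \<otimes> S)"
    unfolding SS using c(1) S by (simp add: m_assoc)
  finally show E11: "E1 \<otimes> E1 = E1" using c S by (simp add: E1)
  \<comment> \<open>\<open>w\<close> acts as the identity on \<open>E1\<close> and is idempotent by
    the next step. The remaining products then follow by expanding w - E1 and 1 - w.\<close>
  have wE1: "w \<otimes> E1 = E1"
    using vS[of r] c S w by (simp add: E1 w_def m_lcomm)
  \<comment> \<open>The exponent 2r is split as (r + 1) + (r - 1), valid for r \<ge> 1, so that the
    relation for \<open>v\<close> applies to the first factor.\<close>
  have "w \<otimes> w = v [^] (r + 1) \<otimes> v [^] (r - 1)"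
    unfolding w_def nat_pow_mult[OF v(1)] using r by simp
  also have "\<dots> = v [^] (1 + (r - 1))"
    unfolding v(2) using v(1) by (subst nat_pow_mult[symmetric]) simp_all
  finally have ww: "w \<otimes> w = w" using r by (simp add: w_def)
  have E1w: "E1 \<otimes> w = E1" using wE1 E1c w by (simp add: m_comm)
  note expand = E2_def E3_def minus_eq r_distr l_distr r_minus l_minus minus_add a_ac
    E11 wE1 E1w ww r_neg l_neg r_neg1 r_neg2
  show "E2 \<otimes> E2 = E2" "E3 \<otimes> E3 = E3" "E1 \<otimes> E2 = \<zero>" "E1 \<otimes> E3 = \<zero>" "E2 \<otimes> E3 = \<zero>"
    using E1c w by (simp_all add: expand)
  show "E1 \<oplus> E2 \<oplus> E3 = \<one>"
    unfolding E2_def E3_def using E1c w by algebra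
qed

text \<open>\<open>r_nonzero\<close> is the form in which the coprimality of \<open>r\<close> and
  \<open>p\<close> enters: it makes 1/r exist in \<open>F\<close>.\<close>

locale idempotent_code = field F for F (structure) +
  fixes r :: nat
  assumes r_gt_1: "r > 1" and r_nonzero: "[r] \<cdot> \<one> \<noteq> \<zero>"
begin

section \<open>The quotient ring F[v]/(v^(r+1) - v)\<close>

abbreviation "V \<equiv> v_ring F r"

sublocale p: UP_domain F "UP F" by unfold_locales

lemma v_poly_closed: "monom (UP F) \<one> (r + 1) \<ominus>\<^bsub>UP F\<^esub> monom (UP F) \<one> 1 \<in> carrier (UP F)"
  by simp

lemma ideal_v_ideal: "ideal (v_ideal F r) (UP F)"
  unfolding v_ideal_def by (rule p.P.cgenideal_ideal[OF v_poly_closed])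

lemma v_class_hom: "ring_hom_cring (UP F) V ((+>\<^bsub>UP F\<^esub>) (v_ideal F r))"
  unfolding v_ring_def by (rule ideal.rcos_ring_hom_cring[OF ideal_v_ideal p.P.is_cring])

sublocale v: ring_hom_cring "UP F" V "(+>\<^bsub>UP F\<^esub>) (v_ideal F r)"
  by (rule v_class_hom)

text \<open>The modulus has degree r + 1, so polynomials of degree at most \<open>r\<close> are
  already reduced and only the zero polynomial among them has class zero.\<close>

lemma v_class_nonzero:
  assumes f: "f \<in> carrier (UP F)" "\<And>i. r < i \<Longrightarrow> coeff (UP F) f i = \<zero>"
    and j: "coeff (UP F) f j \<noteq> \<zero>"
  shows "v_ideal F r +>\<^bsub>UP F\<^esub> f \<noteq> \<zero>\<^bsub>V\<^esub>"
proof
  let ?g = "monom (UP F) \<one> (r + 1) \<ominus>\<^bsub>UP F\<^esub> monom (UP F) \<one> 1"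
  have coeff_g: "coeff (UP F) ?g i = (if i = r + 1 then \<one> else \<zero>) \<ominus> (if i = 1 then \<one> else \<zero>)" for i
    by simp
  have g_nonzero: "?g \<noteq> \<zero>\<^bsub>UP F\<^esub>"
  proof
    assume "?g = \<zero>\<^bsub>UP F\<^esub>"
    then have "coeff (UP F) ?g (r + 1) = \<zero>" by (simp only: p.coeff_zero)
    then show False unfolding coeff_g using r_gt_1 by (simp add: minus_eq)
  qed
  have deg_g: "deg F ?g = r + 1"
  proof (rule le_antisym)
    show "deg F ?g \<le> r + 1"
      by (rule p.deg_aboveI[OF _ v_poly_closed]) (simp only: coeff_g, simp add: minus_eq)
    show "r + 1 \<le> deg F ?g"
      using r_gt_1 by (intro p.deg_belowI[OF _ v_poly_closed]) (simp only: coeff_g, simp add: minus_eq)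
  qed
  assume "v_ideal F r +>\<^bsub>UP F\<^esub> f = \<zero>\<^bsub>V\<^esub>"
  then have "v_ideal F r +>\<^bsub>UP F\<^esub> f = v_ideal F r +>\<^bsub>UP F\<^esub> \<zero>\<^bsub>UP F\<^esub>" by simp
  then have "f \<ominus>\<^bsub>UP F\<^esub> \<zero>\<^bsub>UP F\<^esub> \<in> v_ideal F r"
    using p.P.quotient_eq_iff_same_a_r_cos[OF ideal_v_ideal f(1)] by simp
  then obtain h where h: "h \<in> carrier (UP F)" "f = h \<otimes>\<^bsub>UP F\<^esub> ?g"
    using f(1) by (auto simp: v_ideal_def cgenideal_def p.P.minus_eq)
  have "coeff (UP F) h i = \<zero>" for i
  proof (rule p.deg_mult_lessD[OF h(1) v_poly_closed g_nonzero, of "r + 1"])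
    show "coeff (UP F) (h \<otimes>\<^bsub>UP F\<^esub> ?g) k = \<zero>" if "r + 1 \<le> k" for k
      using f(2)[of k] that unfolding h(2)[symmetric] by simp
    show "deg F ?g \<le> r + 1" "r + 1 - deg F ?g \<le> i"
      unfolding deg_g by simp_all
  qed
  then have "h = \<zero>\<^bsub>UP F\<^esub>" using h(1) by (intro p.up_eqI) simp_all
  with h(2) j show False by simp
qed

lemma v_const_hom: "ring_hom_cring F V (v_const F r)"
proof (rule ring_hom_cringI[OF is_cring v.S.is_cring])
  have "v_const F r = (+>\<^bsub>UP F\<^esub>) (v_ideal F r) \<circ> (\<lambda>a. monom (UP F) a 0)"
    by (simp add: v_const_def fun_eq_iff)
  with ring_hom_trans[OF p.const_ring_hom v.homh] show "v_const F r \<in> ring_hom F V"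
    by simp
qed

sublocale c: ring_hom_cring F V "v_const F r"
  by (rule v_const_hom)

lemma v_elem_closed: "v_elem F r \<in> carrier V"
  by (simp add: v_elem_def)

lemma v_elem_pow: "v_elem F r [^]\<^bsub>V\<^esub> i = v_ideal F r +>\<^bsub>UP F\<^esub> monom (UP F) \<one> i" for i :: nat
proof -
  have "v_elem F r [^]\<^bsub>V\<^esub> i = v_ideal F r +>\<^bsub>UP F\<^esub> (monom (UP F) \<one> 1 [^]\<^bsub>UP F\<^esub> i)"
    by (simp add: v_elem_def)
  then show ?thesis by (simp add: p.monom_pow)
qed

lemma v_elem_pow_Suc_r: "v_elem F r [^]\<^bsub>V\<^esub> (r + 1) = v_elem F r"
proof -
  have "monom (UP F) \<one> (r + 1) \<ominus>\<^bsub>UP F\<^esub> monom (UP F) \<one> 1 \<in> v_ideal F r"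
    unfolding v_ideal_def by (rule p.P.cgenideal_self[OF v_poly_closed])
  then have "v_ideal F r +>\<^bsub>UP F\<^esub> monom (UP F) \<one> (r + 1) = v_ideal F r +>\<^bsub>UP F\<^esub> monom (UP F) \<one> 1"
    by (rule p.P.quotient_eq_iff_same_a_r_cos[OF ideal_v_ideal, THEN iffD1, rotated 2])
      (rule p.monom_closed, rule one_closed)+
  then show ?thesis
    unfolding v_elem_pow by (simp only: v_elem_def)
qed

lemma r_inv: "inv ([r] \<cdot> \<one>) \<in> carrier F" "inv ([r] \<cdot> \<one>) \<otimes> ([r] \<cdot> \<one>) = \<one>"
  using r_nonzero field_Units by auto

lemma frac_r_closed: "frac_r F r m \<in> carrier F"
  using r_inv by (simp add: frac_r_def)

lemma v_const_add_pow: "v_const F r ([m] \<cdot> \<one>) = [m] \<cdot>\<^bsub>V\<^esub> \<one>\<^bsub>V\<^esub>" for m :: nat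
  by (induction m) simp_all

lemma frac_r_1: "frac_r F r 1 \<otimes> ([r] \<cdot> \<one>) = \<one>"
  using r_inv by (simp add: frac_r_def)

lemma frac_r_diff: "frac_r F r (r - 1) \<oplus> frac_r F r 1 = \<one>"
proof -
  \<comment> \<open>The numerators r - 1 and 1 add up to \<open>Suc (r - 1)\<close>, which is
    \<open>r\<close> because \<open>r\<close> is positive.\<close>
  have "frac_r F r (r - 1) \<oplus> frac_r F r 1 = ([Suc (r - 1)] \<cdot> \<one>) \<otimes> inv ([r] \<cdot> \<one>)"
    using r_inv by (simp add: frac_r_def l_distr)
  also have "\<dots> = \<one>"
    using r_gt_1 r_inv m_comm[OF r_inv(1), of "[r] \<cdot> \<one>"] by (simp del: add.nat_pow_Suc)
  finally show ?thesis .
qed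

text \<open>The coefficient \<open>(r - 1)/r\<close> of \<open>v\<^sup>r\<close> in \<open>e2\<close> is \<open>1 - 1/r\<close>.\<close>

lemma e2_altdef: "e2 F r = v_elem F r [^]\<^bsub>V\<^esub> r \<ominus>\<^bsub>V\<^esub> e1 F r"
proof -
  let ?c = "v_const F r (frac_r F r 1)" and ?d = "v_const F r (frac_r F r (r - 1))"
  let ?w = "v_elem F r [^]\<^bsub>V\<^esub> r" and ?T = "\<Oplus>\<^bsub>V\<^esub>i\<in>{1..r - 1}. v_elem F r [^]\<^bsub>V\<^esub> i"
  note closed = v_elem_closed frac_r_closed
  have T: "?T \<in> carrier V" using closed by (auto intro!: v.S.finsum_closed)
  have w: "?w \<in> carrier V" using closed by simp
  have c: "?c \<in> carrier V" and d: "?d \<in> carrier V" using closed by auto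
  have "?d \<oplus>\<^bsub>V\<^esub> ?c = \<one>\<^bsub>V\<^esub>"
    using frac_r_diff closed by (metis c.hom_add c.hom_one)
  then have d_eq: "?d = \<one>\<^bsub>V\<^esub> \<ominus>\<^bsub>V\<^esub> ?c"
    using c d by (metis v.S.add.inv_solve_right v.S.minus_eq v.S.one_closed)
  \<comment> \<open>With the top power \<open>?w\<close> split off the sum in \<open>e1\<close>, the
    difference becomes (1 - c) w - c T, and 1 - c is \<open>?d\<close>.\<close>
  have "{1..r} = insert r {1..r - 1}" using r_gt_1 by auto
  then have "(\<Oplus>\<^bsub>V\<^esub>i\<in>{1..r}. v_elem F r [^]\<^bsub>V\<^esub> i) = ?w \<oplus>\<^bsub>V\<^esub> ?T"
    using r_gt_1 v_elem_closed by (simp add: Pi_def)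
  then show ?thesis
    unfolding e1_def e2_def d_eq using c T w
    by (simp add: v.S.minus_eq v.S.l_distr v.S.r_distr v.S.l_minus v.S.minus_add v.S.a_ac)
qed

lemma e1_closed: "e1 F r \<in> carrier V"
  unfolding e1_def using v_elem_closed frac_r_closed by (auto intro!: v.S.finsum_closed)

lemma e_closed: "e1 F r \<in> carrier V" "e2 F r \<in> carrier V" "e3 F r \<in> carrier V"
  using e1_closed v_elem_closed by (simp_all add: e2_altdef e3_def)

text \<open>This is \<open>orthogonal_idempotents\<close> for the class of \<open>v\<close> and the
  constant 1/r; \<open>e2_altdef\<close> brings \<open>e2\<close> into the shape used there.\<close>

lemma e_orthogonal:
  "e1 F r \<otimes>\<^bsub>V\<^esub> e1 F r = e1 F r" "e2 F r \<otimes>\<^bsub>V\<^esub> e2 F r = e2 F r" "e3 F r \<otimes>\<^bsub>V\<^esub> e3 F r = e3 F r"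
  "e1 F r \<otimes>\<^bsub>V\<^esub> e2 F r = \<zero>\<^bsub>V\<^esub>" "e1 F r \<otimes>\<^bsub>V\<^esub> e3 F r = \<zero>\<^bsub>V\<^esub>" "e2 F r \<otimes>\<^bsub>V\<^esub> e3 F r = \<zero>\<^bsub>V\<^esub>"
  "e2 F r \<otimes>\<^bsub>V\<^esub> e1 F r = \<zero>\<^bsub>V\<^esub>" "e3 F r \<otimes>\<^bsub>V\<^esub> e1 F r = \<zero>\<^bsub>V\<^esub>" "e3 F r \<otimes>\<^bsub>V\<^esub> e2 F r = \<zero>\<^bsub>V\<^esub>"
  "e1 F r \<oplus>\<^bsub>V\<^esub> e2 F r \<oplus>\<^bsub>V\<^esub> e3 F r = \<one>\<^bsub>V\<^esub>"
proof -
  have "v_const F r (frac_r F r 1) \<otimes>\<^bsub>V\<^esub> ([r] \<cdot>\<^bsub>V\<^esub> \<one>\<^bsub>V\<^esub>) = \<one>\<^bsub>V\<^esub>"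
    using frac_r_1 frac_r_closed
    by (metis c.hom_mult c.hom_one v_const_add_pow add.nat_pow_closed one_closed)
  note * = v.S.orthogonal_idempotents[OF v_elem_closed v_elem_pow_Suc_r _ c.hom_closed[OF frac_r_closed] this,
      folded e1_def e3_def, folded e2_altdef]
  show "e1 F r \<otimes>\<^bsub>V\<^esub> e1 F r = e1 F r" "e2 F r \<otimes>\<^bsub>V\<^esub> e2 F r = e2 F r" "e3 F r \<otimes>\<^bsub>V\<^esub> e3 F r = e3 F r"
    and **: "e1 F r \<otimes>\<^bsub>V\<^esub> e2 F r = \<zero>\<^bsub>V\<^esub>" "e1 F r \<otimes>\<^bsub>V\<^esub> e3 F r = \<zero>\<^bsub>V\<^esub>" "e2 F r \<otimes>\<^bsub>V\<^esub> e3 F r = \<zero>\<^bsub>V\<^esub>"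
    and "e1 F r \<oplus>\<^bsub>V\<^esub> e2 F r \<oplus>\<^bsub>V\<^esub> e3 F r = \<one>\<^bsub>V\<^esub>"
    using * r_gt_1 by auto
  from ** show "e2 F r \<otimes>\<^bsub>V\<^esub> e1 F r = \<zero>\<^bsub>V\<^esub>" "e3 F r \<otimes>\<^bsub>V\<^esub> e1 F r = \<zero>\<^bsub>V\<^esub>" "e3 F r \<otimes>\<^bsub>V\<^esub> e2 F r = \<zero>\<^bsub>V\<^esub>"
    using e_closed by (simp_all add: v.S.m_comm)
qed

text \<open>Each idempotent is the class of a polynomial of degree at most \<open>r\<close> with a
  visible nonzero coefficient: 1/r at v for \<open>e1\<close>, -1/r at v for \<open>e2\<close>
  (where r > 1 keeps v^r away), and 1 at degree 0 for \<open>e3\<close>.\<close>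

lemma e_nonzero: "e1 F r \<noteq> \<zero>\<^bsub>V\<^esub>" "e2 F r \<noteq> \<zero>\<^bsub>V\<^esub>" "e3 F r \<noteq> \<zero>\<^bsub>V\<^esub>"
proof -
  let ?a = "frac_r F r 1"
  let ?T = "\<Oplus>\<^bsub>UP F\<^esub>i\<in>{1..r}. monom (UP F) \<one> i"
  let ?f = "?a \<odot>\<^bsub>UP F\<^esub> ?T"
  have a: "?a \<in> carrier F" by (rule frac_r_closed)
  have "?a \<noteq> \<zero>" using frac_r_1 by auto
  have T: "?T \<in> carrier (UP F)" by (auto intro!: p.P.finsum_closed)
  have "coeff (UP F) ?T k = (\<Oplus>i\<in>{1..r}. if k = i then \<one> else \<zero>)" for k
    by (subst p.coeff_finsum) (auto intro!: finsum_cong')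
  moreover have "(\<Oplus>i\<in>{1..r}. if k = i then \<one> else \<zero>) = (if k \<in> {1..r} then \<one> else \<zero>)" for k
  proof (cases "k \<in> {1..r}")
    case True
    then show ?thesis using finsum_singleton[of k "{1..r}" "\<lambda>_. \<one>"] by simp
  next
    case False
    then have "(\<Oplus>i\<in>{1..r}. if k = i then \<one> else \<zero>) = (\<Oplus>i\<in>{1..r}. \<zero>)"
      by (intro finsum_cong') auto
    then show ?thesis using False by simp
  qed
  ultimately have coeff_f: "coeff (UP F) ?f k = (if k \<in> {1..r} then ?a else \<zero>)" for k
    using a T by auto
  have f: "?f \<in> carrier (UP F)" using a T by simp
  have "v_ideal F r +>\<^bsub>UP F\<^esub> ?T = (\<Oplus>\<^bsub>V\<^esub>i\<in>{1..r}. v_elem F r [^]\<^bsub>V\<^esub> i)"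
    unfolding v_elem_pow by (subst v.hom_finsum) (auto simp: comp_def)
  then have e1: "e1 F r = v_ideal F r +>\<^bsub>UP F\<^esub> ?f"
    unfolding e1_def v_const_def using a T
    by (simp add: p.monom_mult_is_smult[symmetric])
  show "e1 F r \<noteq> \<zero>\<^bsub>V\<^esub>"
    unfolding e1
    by (rule v_class_nonzero[OF f, of 1]) (use \<open>?a \<noteq> \<zero>\<close> r_gt_1 in \<open>simp_all only: coeff_f, auto\<close>)
  have e2: "e2 F r = v_ideal F r +>\<^bsub>UP F\<^esub> (monom (UP F) \<one> r \<ominus>\<^bsub>UP F\<^esub> ?f)"
    unfolding e2_altdef e1 v_elem_pow using f by (simp add: p.P.minus_eq v.S.minus_eq)
  have coeff2: "coeff (UP F) (monom (UP F) \<one> r \<ominus>\<^bsub>UP F\<^esub> ?f) k =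
      (if r = k then \<one> else \<zero>) \<ominus> (if k \<in> {1..r} then ?a else \<zero>)" for k
    using f coeff_f[of k] by (simp add: p.coeff_minus del: p.coeff_smult)
  show "e2 F r \<noteq> \<zero>\<^bsub>V\<^esub>"
    unfolding e2
  proof (rule v_class_nonzero)
    show "coeff (UP F) (monom (UP F) \<one> r \<ominus>\<^bsub>UP F\<^esub> ?f) 1 \<noteq> \<zero>"
      unfolding coeff2 using \<open>?a \<noteq> \<zero>\<close> a r_gt_1 by (auto simp: minus_eq)
  qed (use f in \<open>simp, simp only: coeff2, simp add: minus_eq\<close>)
  have e3: "e3 F r = v_ideal F r +>\<^bsub>UP F\<^esub> (\<one>\<^bsub>UP F\<^esub> \<ominus>\<^bsub>UP F\<^esub> monom (UP F) \<one> r)"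
    unfolding e3_def v_elem_pow by (simp add: p.P.minus_eq v.S.minus_eq)
  show "e3 F r \<noteq> \<zero>\<^bsub>V\<^esub>"
    unfolding e3
    by (rule v_class_nonzero[of _ 0]) (use r_gt_1 in \<open>simp_all add: minus_eq\<close>)
qed

section \<open>Componentwise arithmetic in R\<close>

lemma e_comb_add:
  assumes "a \<in> carrier F" "b \<in> carrier F" "c \<in> carrier F" "a' \<in> carrier F" "b' \<in> carrier F" "c' \<in> carrier F"
  shows "e_comb F r a b c \<oplus>\<^bsub>V\<^esub> e_comb F r a' b' c' = e_comb F r (a \<oplus> a') (b \<oplus> b') (c \<oplus> c')"
  unfolding e_comb_def using assms e_closed by (simp add: v.S.r_distr v.S.a_ac)

text \<open>Of the nine products of summands, the six mixed ones vanish by orthogonality and the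
  three others keep their idempotent.\<close>

lemma e_comb_mult:
  assumes "a \<in> carrier F" "b \<in> carrier F" "c \<in> carrier F" "a' \<in> carrier F" "b' \<in> carrier F" "c' \<in> carrier F"
  shows "e_comb F r a b c \<otimes>\<^bsub>V\<^esub> e_comb F r a' b' c' = e_comb F r (a \<otimes> a') (b \<otimes> b') (c \<otimes> c')"
proof -
  have swap: "(x \<otimes>\<^bsub>V\<^esub> v_const F r a) \<otimes>\<^bsub>V\<^esub> (y \<otimes>\<^bsub>V\<^esub> v_const F r b) =
      (x \<otimes>\<^bsub>V\<^esub> y) \<otimes>\<^bsub>V\<^esub> v_const F r (a \<otimes> b)"
    if "x \<in> carrier V" "y \<in> carrier V" "a \<in> carrier F" "b \<in> carrier F" for x y a b
    using that by (simp add: v.S.m_ac)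
  show ?thesis
    unfolding e_comb_def using assms e_closed
    by (simp add: v.S.r_distr v.S.l_distr swap e_orthogonal)
qed

lemma e_comb_closed:
  "a \<in> carrier F \<Longrightarrow> b \<in> carrier F \<Longrightarrow> c \<in> carrier F \<Longrightarrow> e_comb F r a b c \<in> carrier V"
  unfolding e_comb_def using e_closed by simp

text \<open>The idempotents sum to 1, so the constants form the diagonal of the three copies of
  \<open>F\<close>.\<close>

lemma e_comb_const: "a \<in> carrier F \<Longrightarrow> e_comb F r a a a = v_const F r a"
  unfolding e_comb_def using e_closed e_orthogonal(10)
  by (simp add: v.S.l_distr[symmetric])

lemma e_comb_unit:
  "a \<in> carrier F \<Longrightarrow> e_comb F r a \<zero> \<zero> = e1 F r \<otimes>\<^bsub>V\<^esub> v_const F r a"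
  "a \<in> carrier F \<Longrightarrow> e_comb F r \<zero> a \<zero> = e2 F r \<otimes>\<^bsub>V\<^esub> v_const F r a"
  "a \<in> carrier F \<Longrightarrow> e_comb F r \<zero> \<zero> a = e3 F r \<otimes>\<^bsub>V\<^esub> v_const F r a"
  unfolding e_comb_def using e_closed by simp_all

text \<open>A nonzero difference a - b is invertible in the field, so e (a - b) = 0 would force
  \<open>e\<close> to vanish.\<close>

lemma scaled_const_inj:
  assumes "e \<in> carrier V" "e \<noteq> \<zero>\<^bsub>V\<^esub>" "a \<in> carrier F" "b \<in> carrier F"
    and "e \<otimes>\<^bsub>V\<^esub> v_const F r a = e \<otimes>\<^bsub>V\<^esub> v_const F r b"
  shows "a = b"
proof (rule ccontr)
  assume "a \<noteq> b"
  then have "a \<ominus> b \<in> Units F" using assms by (simp add: field_Units)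
  then have inv: "inv (a \<ominus> b) \<in> carrier F" "(a \<ominus> b) \<otimes> inv (a \<ominus> b) = \<one>" by auto
  have "e = e \<otimes>\<^bsub>V\<^esub> v_const F r ((a \<ominus> b) \<otimes> inv (a \<ominus> b))"
    using assms by (simp add: inv)
  also have "\<dots> = (e \<otimes>\<^bsub>V\<^esub> v_const F r a \<ominus>\<^bsub>V\<^esub> e \<otimes>\<^bsub>V\<^esub> v_const F r b) \<otimes>\<^bsub>V\<^esub> v_const F r (inv (a \<ominus> b))"
    using assms(1,3,4) inv(1)
    by (simp add: v.S.minus_eq minus_eq v.S.r_distr v.S.r_minus v.S.l_minus v.S.m_assoc v.S.l_distr)
  also have "\<dots> = \<zero>\<^bsub>V\<^esub>" using assms inv by (simp add: v.S.minus_eq v.S.r_neg)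
  finally show False using assms by simp
qed

text \<open>Multiplying by one of the idempotents isolates one coordinate, which
  \<open>scaled_const_inj\<close> then recovers.\<close>

lemma e_comb_inj:
  assumes "a \<in> carrier F" "b \<in> carrier F" "c \<in> carrier F" "a' \<in> carrier F" "b' \<in> carrier F" "c' \<in> carrier F"
    and "e_comb F r a b c = e_comb F r a' b' c'"
  shows "a = a' \<and> b = b' \<and> c = c'"
proof -
  have proj: "e_comb F r \<one> \<zero> \<zero> \<otimes>\<^bsub>V\<^esub> e_comb F r a b c = e1 F r \<otimes>\<^bsub>V\<^esub> v_const F r a"
    "e_comb F r \<zero> \<one> \<zero> \<otimes>\<^bsub>V\<^esub> e_comb F r a b c = e2 F r \<otimes>\<^bsub>V\<^esub> v_const F r b"
    "e_comb F r \<zero> \<zero> \<one> \<otimes>\<^bsub>V\<^esub> e_comb F r a b c = e3 F r \<otimes>\<^bsub>V\<^esub> v_const F r c"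
    if "a \<in> carrier F" "b \<in> carrier F" "c \<in> carrier F" for a b c
    using that by (subst e_comb_mult; simp add: e_comb_unit)+
  from proj[of a b c] proj[of a' b' c'] assms
  have "e1 F r \<otimes>\<^bsub>V\<^esub> v_const F r a = e1 F r \<otimes>\<^bsub>V\<^esub> v_const F r a'"
    "e2 F r \<otimes>\<^bsub>V\<^esub> v_const F r b = e2 F r \<otimes>\<^bsub>V\<^esub> v_const F r b'"
    "e3 F r \<otimes>\<^bsub>V\<^esub> v_const F r c = e3 F r \<otimes>\<^bsub>V\<^esub> v_const F r c'"
    by simp_all
  with assms e_closed e_nonzero show ?thesis by (metis scaled_const_inj)
qed

lemma R_ring_simps:
  "carrier (R_ring F r) = {e_comb F r a b c |a b c. a \<in> carrier F \<and> b \<in> carrier F \<and> c \<in> carrier F}"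
  "mult (R_ring F r) = mult V" "add (R_ring F r) = add V"
  "\<one>\<^bsub>R_ring F r\<^esub> = \<one>\<^bsub>V\<^esub>" "\<zero>\<^bsub>R_ring F r\<^esub> = \<zero>\<^bsub>V\<^esub>"
  by (simp_all add: R_ring_def)

lemma cring_R_ring: "cring (R_ring F r)"
proof -
  let ?H = "{e_comb F r a b c |a b c. a \<in> carrier F \<and> b \<in> carrier F \<and> c \<in> carrier F}"
  have "subring ?H V"
  proof (rule v.S.subringI)
    show "?H \<subseteq> carrier V" using e_comb_closed by auto
    show "\<one>\<^bsub>V\<^esub> \<in> ?H"
      using e_comb_const[of \<one>] by (metis (mono_tags, lifting) c.hom_one mem_Collect_eq one_closed)
    fix x assume "x \<in> ?H"
    then obtain a b c where x: "x = e_comb F r a b c" and abc: "a \<in> carrier F" "b \<in> carrier F" "c \<in> carrier F"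
      by auto
    have "\<ominus>\<^bsub>V\<^esub> x = e_comb F r (\<ominus> a) (\<ominus> b) (\<ominus> c)"
      unfolding x e_comb_def using abc e_closed by (simp add: v.S.minus_add v.S.r_minus)
    with abc show "\<ominus>\<^bsub>V\<^esub> x \<in> ?H" by (blast intro: a_inv_closed)
    fix y assume "y \<in> ?H"
    then obtain a' b' c' where y: "y = e_comb F r a' b' c'" and abc': "a' \<in> carrier F" "b' \<in> carrier F" "c' \<in> carrier F"
      by auto
    show "x \<otimes>\<^bsub>V\<^esub> y \<in> ?H"
      unfolding x y e_comb_mult[OF abc abc'] using abc abc' by blast
    show "x \<oplus>\<^bsub>V\<^esub> y \<in> ?H"
      unfolding x y e_comb_add[OF abc abc'] using abc abc' by blast
  qed
  then show ?thesis
    unfolding R_ring_def using v.S.subcring_iff v.S.subcringI' subringE(1) by blast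
qed

text \<open>The constants lie in \<open>R_ring F r\<close>, so the results on coefficientwise
  extension apply to the passage from \<open>F\<close> to this ring.\<close>

lemma v_const_hom_R: "ring_hom_cring F (R_ring F r) (v_const F r)"
proof (rule ring_hom_cringI[OF is_cring cring_R_ring ring_hom_memI])
  fix a assume "a \<in> carrier F"
  then show "v_const F r a \<in> carrier (R_ring F r)"
    using e_comb_const[of a] by (auto simp: R_ring_simps)
qed (simp_all add: R_ring_simps)

lemma e_closed_R: "e1 F r \<in> carrier (R_ring F r)" "e2 F r \<in> carrier (R_ring F r)" "e3 F r \<in> carrier (R_ring F r)"
  using e_comb_unit[of \<one>] e_closed unfolding R_ring_simps
  by (simp_all, (metis one_closed zero_closed)+)

section \<open>Decomposition of cyclic codes\<close>

abbreviation words :: "nat \<Rightarrow> (nat \<Rightarrow> 'a) set" where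
  "words n \<equiv> {..<n} \<rightarrow>\<^sub>E carrier F"

lemma word_comb_inj:
  assumes "s \<in> words n" "t \<in> words n" "u \<in> words n" "s' \<in> words n" "t' \<in> words n" "u' \<in> words n"
    and eq: "word_comb F r n s t u = word_comb F r n s' t' u'"
  shows "s = s' \<and> t = t' \<and> u = u'"
proof -
  have "s i = s' i \<and> t i = t' i \<and> u i = u' i" if "i < n" for i
  proof (rule e_comb_inj)
    show "e_comb F r (s i) (t i) (u i) = e_comb F r (s' i) (t' i) (u' i)"
      using fun_cong[OF eq, of i] that by (simp add: word_comb_def)
  qed (simp_all add: that assms(1-6)[THEN PiE_mem])
  then show ?thesis
    by (intro conjI PiE_ext[OF assms(1,4)] PiE_ext[OF assms(2,5)] PiE_ext[OF assms(3,6)]) simp_all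
qed

lemma code_subset: "code1 F r n C \<subseteq> words n" "code2 F r n C \<subseteq> words n" "code3 F r n C \<subseteq> words n"
  by (auto simp: code1_def code2_def code3_def word_module_simps)

abbreviation scaled_word :: "nat \<Rightarrow> (nat \<Rightarrow> 'a) set \<Rightarrow> (nat \<Rightarrow> 'a) \<Rightarrow> nat \<Rightarrow> (nat \<Rightarrow> 'a) set" where
  "scaled_word n e s \<equiv> \<lambda>i\<in>{..<n}. e \<otimes>\<^bsub>R_ring F r\<^esub> v_const F r (s i)"

text \<open>The nested binary sums have the shape of the sum rule in \<open>cyclic_codeD\<close> and
  of \<open>word_poly_add\<close>, each of which is applied twice.\<close>

lemma word_comb_sum:
  assumes "s \<in> words n" "t \<in> words n" "u \<in> words n"
  shows "word_comb F r n s t u = (\<lambda>i\<in>{..<n}.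
    (\<lambda>i\<in>{..<n}. scaled_word n (e1 F r) s i \<oplus>\<^bsub>R_ring F r\<^esub> scaled_word n (e2 F r) t i) i
      \<oplus>\<^bsub>R_ring F r\<^esub> scaled_word n (e3 F r) u i)"
  by (rule ext) (simp add: word_comb_def R_ring_simps e_comb_def)

text \<open>Multiplying a codeword that has the given component by the matching idempotent kills the
  other two components, and \<open>C\<close> is closed under scalars from
  \<open>R_ring F r\<close>.\<close>

lemma scaled_word_mem_code:
  assumes C: "cyclic_code (R_ring F r) n C"
  shows "s \<in> code1 F r n C \<Longrightarrow> scaled_word n (e1 F r) s \<in> C"
    and "t \<in> code2 F r n C \<Longrightarrow> scaled_word n (e2 F r) t \<in> C"
    and "u \<in> code3 F r n C \<Longrightarrow> scaled_word n (e3 F r) u \<in> C"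
proof -
  have proj: "(\<lambda>i\<in>{..<n}. e1 F r \<otimes>\<^bsub>R_ring F r\<^esub> word_comb F r n s t u i) = scaled_word n (e1 F r) s"
    "(\<lambda>i\<in>{..<n}. e2 F r \<otimes>\<^bsub>R_ring F r\<^esub> word_comb F r n s t u i) = scaled_word n (e2 F r) t"
    "(\<lambda>i\<in>{..<n}. e3 F r \<otimes>\<^bsub>R_ring F r\<^esub> word_comb F r n s t u i) = scaled_word n (e3 F r) u"
    if "s \<in> words n" "t \<in> words n" "u \<in> words n" for s t u
  proof -
    have "s i \<in> carrier F" "t i \<in> carrier F" "u i \<in> carrier F" if "i < n" for i
      using \<open>s \<in> words n\<close> \<open>t \<in> words n\<close> \<open>u \<in> words n\<close> that by auto
    then show "(\<lambda>i\<in>{..<n}. e1 F r \<otimes>\<^bsub>R_ring F r\<^esub> word_comb F r n s t u i) = scaled_word n (e1 F r) s"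
      "(\<lambda>i\<in>{..<n}. e2 F r \<otimes>\<^bsub>R_ring F r\<^esub> word_comb F r n s t u i) = scaled_word n (e2 F r) t"
      "(\<lambda>i\<in>{..<n}. e3 F r \<otimes>\<^bsub>R_ring F r\<^esub> word_comb F r n s t u i) = scaled_word n (e3 F r) u"
      using e_closed
      by (auto intro!: restrict_ext simp: word_comb_def R_ring_simps e_comb_def v.S.r_distr
          v.S.m_assoc[symmetric] e_orthogonal)
  qed
  note mult = cyclic_codeD(4)[OF C]
  show "scaled_word n (e1 F r) s \<in> C" if s: "s \<in> code1 F r n C"
  proof -
    obtain t u where "s \<in> words n" "t \<in> words n" "u \<in> words n" and "word_comb F r n s t u \<in> C"
      using s by (auto simp: code1_def word_module_simps)
    then show ?thesis using mult[OF e_closed_R(1)] proj(1) by metis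
  qed
  show "scaled_word n (e2 F r) t \<in> C" if t: "t \<in> code2 F r n C"
  proof -
    obtain s u where "s \<in> words n" "t \<in> words n" "u \<in> words n" and "word_comb F r n s t u \<in> C"
      using t by (auto simp: code2_def word_module_simps)
    then show ?thesis using mult[OF e_closed_R(2)] proj(2) by metis
  qed
  show "scaled_word n (e3 F r) u \<in> C" if u: "u \<in> code3 F r n C"
  proof -
    obtain s t where "s \<in> words n" "t \<in> words n" "u \<in> words n" and "word_comb F r n s t u \<in> C"
      using u by (auto simp: code3_def word_module_simps)
    then show ?thesis using mult[OF e_closed_R(3)] proj(3) by metis
  qed
qed

text \<open>The components \<open>s\<close>, \<open>t\<close>, \<open>u\<close> on the right may
  stem from three different codewords. Their isolated parts all lie in \<open>C\<close>, so the sum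
  of these parts does too.\<close>

lemma code_decomposition:
  assumes C: "cyclic_code (R_ring F r) n C"
  shows "C = (\<lambda>(s, t, u). word_comb F r n s t u) ` (code1 F r n C \<times> code2 F r n C \<times> code3 F r n C)"
proof (intro subset_antisym subsetI)
  fix c assume c: "c \<in> C"
  then have cW: "c \<in> {..<n} \<rightarrow>\<^sub>E carrier (R_ring F r)"
    using cyclic_codeD(1)[OF C] by auto
  have "\<exists>a b d. a \<in> carrier F \<and> b \<in> carrier F \<and> d \<in> carrier F \<and> c i = e_comb F r a b d" if "i < n" for i
  proof -
    have "c i \<in> carrier (R_ring F r)" using PiE_mem[OF cW] that by simp
    then show ?thesis by (auto simp: R_ring_simps)
  qed
  then obtain s' t' u' where x: "\<And>i. i < n \<Longrightarrow> s' i \<in> carrier F \<and> t' i \<in> carrier F \<and> u' i \<in> carrier F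
      \<and> c i = e_comb F r (s' i) (t' i) (u' i)"
    by metis
  \<comment> \<open>Words are extensional, so the chosen coordinate functions are cut down to
    \<open>{..<n}\<close>.\<close>
  define s t u where "s = restrict s' {..<n}" and "t = restrict t' {..<n}" and "u = restrict u' {..<n}"
  have words: "s \<in> words n" "t \<in> words n" "u \<in> words n"
    using x by (auto simp: s_def t_def u_def)
  have "c = word_comb F r n s t u"
  proof
    show "c i = word_comb F r n s t u i" for i
      using x[of i] PiE_arb[OF cW, of i] by (auto simp: word_comb_def s_def t_def u_def)
  qed
  moreover from this c words have "s \<in> code1 F r n C" "t \<in> code2 F r n C" "u \<in> code3 F r n C"
    by (auto simp: code1_def code2_def code3_def word_module_simps)
  ultimately show "c \<in> (\<lambda>(s, t, u). word_comb F r n s t u) ` (code1 F r n C \<times> code2 F r n C \<times> code3 F r n C)"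
    by (intro image_eqI[of _ _ "(s, t, u)"]) simp_all
next
  fix c assume "c \<in> (\<lambda>(s, t, u). word_comb F r n s t u) ` (code1 F r n C \<times> code2 F r n C \<times> code3 F r n C)"
  then obtain s t u where c: "c = word_comb F r n s t u"
    and stu: "s \<in> code1 F r n C" "t \<in> code2 F r n C" "u \<in> code3 F r n C"
    by auto
  have "s \<in> words n" "t \<in> words n" "u \<in> words n"
    by (rule subsetD[OF code_subset(1) stu(1)] subsetD[OF code_subset(2) stu(2)] subsetD[OF code_subset(3) stu(3)])+
  then show "c \<in> C"
    unfolding c using word_comb_sum
    by (simp only:) (intro cyclic_codeD(3)[OF C] scaled_word_mem_code[OF C] stu)
qed

text \<open>Coordinates of letters are unique, so the decomposition map is injective on all triples
  of words and in particular on triples of component codewords.\<close>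

lemma card_code:
  assumes C: "cyclic_code (R_ring F r) n C"
  shows "card C = card (code1 F r n C) * card (code2 F r n C) * card (code3 F r n C)"
proof -
  have "inj_on (\<lambda>(s, t, u). word_comb F r n s t u) (words n \<times> words n \<times> words n)"
  proof (rule inj_onI)
    fix x y assume "x \<in> words n \<times> words n \<times> words n" "y \<in> words n \<times> words n \<times> words n"
      and "(\<lambda>(s, t, u). word_comb F r n s t u) x = (\<lambda>(s, t, u). word_comb F r n s t u) y"
    then show "x = y"
      using word_comb_inj[of "fst x" n "fst (snd x)" "snd (snd x)" "fst y" "fst (snd y)" "snd (snd y)"]
      by (simp add: mem_Times_iff case_prod_unfold prod_eq_iff)
  qed
  then have "inj_on (\<lambda>(s, t, u). word_comb F r n s t u) (code1 F r n C \<times> code2 F r n C \<times> code3 F r n C)"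
    by (rule inj_on_subset) (intro Sigma_mono code_subset)
  then have "card C = card (code1 F r n C \<times> code2 F r n C \<times> code3 F r n C)"
    by (subst code_decomposition[OF C]) (rule card_image)
  then show ?thesis by (simp add: card_cartesian_product)
qed

text \<open>The three generators lie in the ideal given by \<open>C\<close>, so the ideal they
  generate does as well. Conversely a codeword is a sum of three scaled words, each lying in the
  generated ideal by \<open>scaled_word_mem\<close>.\<close>

lemma code_classes_eq_Idl:
  assumes C: "cyclic_code (R_ring F r) n C" and n: "n \<ge> 1"
    and g: "generator_poly F n (code1 F r n C) g1" "generator_poly F n (code2 F r n C) g2"
      "generator_poly F n (code3 F r n C) g3"
  shows "code_classes (R_ring F r) n C =
    Idl\<^bsub>cyclic_ring (R_ring F r) n\<^esub>
      {cyclic_class (R_ring F r) n (scaled_poly F r (e1 F r) g1),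
       cyclic_class (R_ring F r) n (scaled_poly F r (e2 F r) g2),
       cyclic_class (R_ring F r) n (scaled_poly F r (e3 F r) g3)}"
    (is "_ = Idl\<^bsub>?Q\<^esub> ?G")
proof -
  interpret h: ring_hom_cring F "R_ring F r" "v_const F r" by (rule v_const_hom_R)
  interpret U: UP_cring "R_ring F r" "UP (R_ring F r)" by unfold_locales
  interpret Q: cring ?Q by (rule U.cring_cyclic_ring)
  interpret K: ring_hom_cring "UP (R_ring F r)" ?Q "cyclic_class (R_ring F r) n"
    by (rule U.ring_hom_cyclic_class)
  have ideal: "ideal (code_classes (R_ring F r) n C) ?Q"
    by (rule U.ideal_code_classes[OF C n])
  have G: "?G \<subseteq> code_classes (R_ring F r) n C"
    using h.scaled_generator_mem[OF e_closed_R(1) g(1) code_subset(1) scaled_word_mem_code(1)[OF C]]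
      h.scaled_generator_mem[OF e_closed_R(2) g(2) code_subset(2) scaled_word_mem_code(2)[OF C]]
      h.scaled_generator_mem[OF e_closed_R(3) g(3) code_subset(3) scaled_word_mem_code(3)[OF C]]
    by (simp add: scaled_poly_def)
  then have G': "?G \<subseteq> carrier ?Q"
    using additive_subgroup.a_subset[OF ideal.axioms(1)[OF ideal]] by (rule subset_trans)
  note I = Q.genideal_ideal[OF G'] and GI = Q.genideal_self[OF G']
  show ?thesis
  proof (rule subset_antisym)
    show "Idl\<^bsub>?Q\<^esub> ?G \<subseteq> code_classes (R_ring F r) n C"
      by (rule Q.genideal_minimal[OF ideal G])
    show "code_classes (R_ring F r) n C \<subseteq> Idl\<^bsub>?Q\<^esub> ?G"
    proof
      fix x assume "x \<in> code_classes (R_ring F r) n C"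
      then obtain c where "c \<in> C" and x: "x = cyclic_class (R_ring F r) n (word_poly (R_ring F r) n c)"
        by (auto simp: code_classes_def)
      from subsetD[OF equalityD1[OF code_decomposition[OF C]] \<open>c \<in> C\<close>]
      obtain s t u where c: "c = word_comb F r n s t u"
        and stu: "s \<in> code1 F r n C" "t \<in> code2 F r n C" "u \<in> code3 F r n C"
        by auto
      have words: "s \<in> words n" "t \<in> words n" "u \<in> words n"
    by (rule subsetD[OF code_subset(1) stu(1)] subsetD[OF code_subset(2) stu(2)] subsetD[OF code_subset(3) stu(3)])+
      have scaled: "scaled_word n e s \<in> {..<n} \<rightarrow> carrier (R_ring F r)"
        if "e \<in> carrier (R_ring F r)" "s \<in> words n" for e s
        using that by auto
      let ?S = "scaled_word n (e1 F r) s" and ?T = "scaled_word n (e2 F r) t" and ?U = "scaled_word n (e3 F r) u"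
      note S = scaled[OF e_closed_R(1) words(1)] and T = scaled[OF e_closed_R(2) words(2)]
        and U = scaled[OF e_closed_R(3) words(3)]
      have ST: "(\<lambda>i\<in>{..<n}. ?S i \<oplus>\<^bsub>R_ring F r\<^esub> ?T i) \<in> {..<n} \<rightarrow> carrier (R_ring F r)"
      proof (rule funcsetI)
        fix i assume i: "i \<in> {..<n}"
        from h.S.a_closed[OF funcset_mem[OF S i] funcset_mem[OF T i]] i
        show "(\<lambda>i\<in>{..<n}. ?S i \<oplus>\<^bsub>R_ring F r\<^esub> ?T i) i \<in> carrier (R_ring F r)" by simp
      qed
      have "x = cyclic_class (R_ring F r) n (word_poly (R_ring F r) n ?S)
          \<oplus>\<^bsub>?Q\<^esub> cyclic_class (R_ring F r) n (word_poly (R_ring F r) n ?T)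
          \<oplus>\<^bsub>?Q\<^esub> cyclic_class (R_ring F r) n (word_poly (R_ring F r) n ?U)"
        unfolding x c word_comb_sum[OF words] U.word_poly_add[OF ST U] U.word_poly_add[OF S T]
        by (simp only: K.hom_add U.word_poly_closed S T U U.UP_a_closed)
      moreover have "cyclic_class (R_ring F r) n (word_poly (R_ring F r) n ?S) \<in> Idl\<^bsub>?Q\<^esub> ?G"
        by (rule h.scaled_word_mem[OF e_closed_R(1) g(1) code_subset(1) I _ stu(1)])
          (rule subsetD[OF GI], simp add: scaled_poly_def)
      moreover have "cyclic_class (R_ring F r) n (word_poly (R_ring F r) n ?T) \<in> Idl\<^bsub>?Q\<^esub> ?G"
        by (rule h.scaled_word_mem[OF e_closed_R(2) g(2) code_subset(2) I _ stu(2)])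
          (rule subsetD[OF GI], simp add: scaled_poly_def)
      moreover have "cyclic_class (R_ring F r) n (word_poly (R_ring F r) n ?U) \<in> Idl\<^bsub>?Q\<^esub> ?G"
        by (rule h.scaled_word_mem[OF e_closed_R(3) g(3) code_subset(3) I _ stu(3)])
          (rule subsetD[OF GI], simp add: scaled_poly_def)
      ultimately show "x \<in> Idl\<^bsub>?Q\<^esub> ?G"
        using I by (simp add: additive_subgroup.a_closed ideal.axioms(1))
    qed
  qed
qed

end

section \<open>Invertibility of r and the count over a field with p^k elements\<close>

theorem theorem4:
  fixes F :: "('a, 'm) ring_scheme"
    and p k r n :: nat
    and C :: "(nat \<Rightarrow> (nat \<Rightarrow> 'a) set) set"
    and g1 g2 g3 :: "nat \<Rightarrow> 'a"
  assumes "Factorial_Ring.prime p"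
    and "k \<ge> 1"
    and "r > 1"
    and "coprime r p"
    and "field F"
    and "card (carrier F) = p ^ k"
    and "n \<ge> 1"
    and "cyclic_code (R_ring F r) n C"
    and "generator_poly F n (code1 F r n C) g1"
    and "generator_poly F n (code2 F r n C) g2"
    and "generator_poly F n (code3 F r n C) g3"
  shows "code_classes (R_ring F r) n C =
           Idl\<^bsub>cyclic_ring (R_ring F r) n\<^esub>
             {cyclic_class (R_ring F r) n (scaled_poly F r (e1 F r) g1),
              cyclic_class (R_ring F r) n (scaled_poly F r (e2 F r) g2),
              cyclic_class (R_ring F r) n (scaled_poly F r (e3 F r) g3)}
         \<and> card C = p ^ (k * (3 * n - deg F g1 - deg F g2 - deg F g3))"
proof -
  interpret F: field F by fact
  have "[r] \<cdot>\<^bsub>F\<^esub> \<one>\<^bsub>F\<^esub> \<noteq> \<zero>\<^bsub>F\<^esub>"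
  proof
    assume r0: "[r] \<cdot>\<^bsub>F\<^esub> \<one>\<^bsub>F\<^esub> = \<zero>\<^bsub>F\<^esub>"
    \<comment> \<open>The additive group of \<open>F\<close> has p^k elements, so p^k times 1
      vanishes.\<close>
    have q0: "[(p ^ k)] \<cdot>\<^bsub>F\<^esub> \<one>\<^bsub>F\<^esub> = \<zero>\<^bsub>F\<^esub>"
      using F.add.pow_order_eq_1[of "\<one>\<^bsub>F\<^esub>"] assms(6) by (simp add: order_def)
    have "coprime r (p ^ k)" using assms(4) by simp
    moreover have "r \<noteq> 0" using assms(3) by simp
    \<comment> \<open>Bezout in subtraction-free form: if r times 1 vanished as well, this identity
      taken in \<open>F\<close> would read 0 = 1.\<close>
    ultimately obtain x y where "r * x = p ^ k * y + 1"
      by (metis bezout_nat coprime_imp_gcd_eq_1)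
    then have "[x] \<cdot>\<^bsub>F\<^esub> ([r] \<cdot>\<^bsub>F\<^esub> \<one>\<^bsub>F\<^esub>) = [y] \<cdot>\<^bsub>F\<^esub> ([(p ^ k)] \<cdot>\<^bsub>F\<^esub> \<one>\<^bsub>F\<^esub>) \<oplus>\<^bsub>F\<^esub> \<one>\<^bsub>F\<^esub>"
      by (simp add: F.add.nat_pow_pow)
    then show False unfolding r0 q0 by simp
  qed
  then interpret idempotent_code F r
    using assms(3) by unfold_locales
  have deg: "deg F g1 \<le> n" "deg F g2 \<le> n" "deg F g3 \<le> n"
    using p.deg_generator_poly_le assms(7,9-11) by auto
  have "card C = (p ^ k) ^ (n - deg F g1) * (p ^ k) ^ (n - deg F g2) * (p ^ k) ^ (n - deg F g3)"
    unfolding card_code[OF assms(8)] assms(6)[symmetric]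
    using p.card_generator_poly_code[OF _ assms(7) code_subset(1)] assms(9)
      p.card_generator_poly_code[OF _ assms(7) code_subset(2)] assms(10)
      p.card_generator_poly_code[OF _ assms(7) code_subset(3)] assms(11)
    by simp
  \<comment> \<open>Each factor is a power of the field size p^k, which brings \<open>k\<close> into
    the exponent. The bounds in \<open>deg\<close> make the truncated subtraction from 3n agree with
    the sum of the three differences.\<close>
  also have "\<dots> = p ^ (k * (3 * n - deg F g1 - deg F g2 - deg F g3))"
  proof -
    have "3 * n - deg F g1 - deg F g2 - deg F g3 = (n - deg F g1) + (n - deg F g2) + (n - deg F g3)"
      using deg by simp
    then show ?thesis by (simp add: power_mult power_add)
  qed
  finally show ?thesis
    using code_classes_eq_Idl[OF assms(8,7,9-11)] by simp
qed

end
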